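(* Let $f:\mathbb{R}^d\to\mathbb{R}$ be $C^1$ with $\nabla f$ Lipschitz continuous on $\mathbb{R}^d$ with constant $L>0$, bounded from below, with set of minimizers $\mathcal M=\{x: f(x)=\inf f\}$, and let $\mu>0$. Assume that the closest point projection onto $\mathcal M$ is an affine linear map $\pi(x)=Px+x^*$ as described in the context, that $$\langle\nabla f(x),x-\pi(x)\rangle\ge f(x)-f(\pi(x))+\frac{\mu}{2}\|x-\pi(x)\|^2\qquad\text{for all }x\in\mathbb{R}^d,$$ and that for some $\varepsilon$ $$\langle\nabla f(x+v),v\rangle\ge f(x+v)-f(x)-\frac{\varepsilon}{2}\|v\|^2\qquad\text{for all }x,v\in\mathbb{R}^d.$$ Let $(\Omega,\mathcal A,\mathbb Q)$ be a probability space and $g:\mathbb{R}^d\times\Omega\to\mathbb{R}^d$ a measurable function such that for all $x\in\mathbb{R}^d$ $$\mathbb{E}_{\omega\sim\mathbb Q}[g(x,\omega)]=\nabla f(x),\qquad \mathbb{E}_{\omega\sim\mathbb Q}[\|g(x,\omega)\|^2]<\infty,\qquad \mathbb{E}_{\omega\sim\mathbb Q}[\|g(x,\omega)-\nabla f(x)\|^2]\le\sigma_a^2$$ for some $\sigma_a\ge 0$. Let $$\eta_n=\frac{1}{\mu\,\big(n+\sqrt{L/\mu}+1\big)^2},\qquad \rho_n=\frac{1-\sqrt{\mu\eta_n}}{1+\sqrt{\mu\eta_n}}.$$ Let $x_0$ be a (possibly random) initial condition in $\mathbb{R}^d$, $v_0=0$, let $\omega_0,\omega_1,\dots$ be drawn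 with law $\mathbb Q$ independently of each other and of $x_0$, and let $$x_n'=x_n+\sqrt{\eta_{n-1}}\,v_n,\qquad g_n=g(x_n',\omega_n),\qquad x_{n+1}=x_n'-\eta_n g_n,\qquad v_{n+1}=\rho_n\,(v_n-\sqrt{\eta_n}\,g_n)$$ (so that $x_0'=x_0$). If $\varepsilon\le\sqrt{\mu/\eta_0}=\mu+\sqrt{L\mu}$, then for all $n\ge 0$ $$\mathbb{E}[f(x_n)-\inf f]\le\frac{\sqrt{\frac{L}{\mu}}\;\mathbb{E}\left[f(x_0)-\inf f+\frac{\mu}{2}\|x_0-\pi(x_0)\|^2\right]+\frac{\sigma_a^2}{\mu}\log\left(1+n\sqrt{\mu/L}\right)}{n+\sqrt{L/\mu}}.$$
   Context: Affine projection: $V\subset\mathbb{R}^d$ is a linear subspace of dimension $k<d$, $P:\mathbb{R}^d\to\mathbb{R}^d$ is the orthogonal projection onto $V$, $x^*$ is the (unique) element of smallest Euclidean norm in the affine space $x^*+V$ (equivalently $x^*\perp V$), the set of minimizers $\mathcal M=\{x\in\mathbb{R}^d: f(x)=\inf_{z} f(z)\}$ is non-empty and equals $x^*+V$, and $\pi(x)=Px+x^*$ is the closest point projection onto $\mathcal M$. Unsubscripted expectations are over $x_0$ and all $\omega_i$. *)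

theory Defs
  imports "HOL-Probability.Probability"
begin

definition minimizers :: "('a \<Rightarrow> real) \<Rightarrow> 'a set" where
  "minimizers f = {x. f x = (INF z. f z)}"

definition is_orthogonal_projection :: "'a::real_inner set \<Rightarrow> ('a \<Rightarrow> 'a) \<Rightarrow> bool" where
  "is_orthogonal_projection V P \<longleftrightarrow>
     (\<forall>x. P x \<in> V \<and> (\<forall>v\<in>V. inner (x - P x) v = 0))"

text \<open>The index is an integer because the scheme below refers to the step size of index
  \<open>n - 1\<close> already for \<open>n = 0\<close>, where it is only ever multiplied by the zero initial velocity.\<close>

definition step_size :: "real \<Rightarrow> real \<Rightarrow> int \<Rightarrow> real" where
  "step_size L \<mu> n = 1 / (\<mu> * (of_int n + sqrt (L / \<mu>) + 1)\<^sup>2)"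

definition momentum :: "real \<Rightarrow> real \<Rightarrow> int \<Rightarrow> real" where
  "momentum L \<mu> n = (1 - sqrt (\<mu> * step_size L \<mu> n)) / (1 + sqrt (\<mu> * step_size L \<mu> n))"

lemma sqrt_div_step_size_0:
  assumes "L > 0" "\<mu> > 0"
  shows "sqrt (\<mu> / step_size L \<mu> 0) = \<mu> + sqrt (L * \<mu>)"
proof -
  have "\<mu> / step_size L \<mu> 0 = (\<mu> * (sqrt (L / \<mu>) + 1))\<^sup>2"
    by (simp add: step_size_def power_mult_distrib power2_eq_square)
  moreover have "\<mu> * sqrt (L / \<mu>) = sqrt (L * \<mu>)"
  proof -
    have "\<mu> * sqrt (L / \<mu>) = sqrt (\<mu>\<^sup>2 * (L / \<mu>))"
      using assms by (subst real_sqrt_mult) simp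
    also have "\<mu>\<^sup>2 * (L / \<mu>) = L * \<mu>"
      using assms by (simp add: power2_eq_square)
    finally show ?thesis .
  qed
  moreover have "\<mu> * (sqrt (L / \<mu>) + 1) \<ge> 0"
    using assms by simp
  ultimately show ?thesis
    by (simp add: distrib_left)
qed

end

theory Submission
  imports Defs
begin

text \<open>
  Put \<open>N = n + sqrt (L / \<mu>)\<close> and \<open>q = 1 / (N + 1)\<close>. Then \<open>sqrt \<eta>\<^sub>n = q / sqrt \<mu>\<close>, the momentum is
  \<open>(1 - q) / (1 + q)\<close>, and passing from \<open>\<eta>\<^sub>n\<^sub>-\<^sub>1\<close> to \<open>\<eta>\<^sub>n\<close> multiplies the square root of the step size
  by \<open>1 - q = N / (N + 1)\<close>. With \<open>R = id - P\<close>, the proof shows that the expectation of an energy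
  \<open>E\<^sub>n = f x\<^sub>n - inf f + |\<alpha>\<^sub>n R v\<^sub>n + sqrt \<mu> (x\<^sub>n' - \<pi> x\<^sub>n')|\<^sup>2 / 2 + \<lambda>\<^sub>n |P v\<^sub>n|\<^sup>2 / 2\<close>
  contracts by the factor \<open>1 - q\<close>, up to a noise term \<open>\<sigma>\<^sup>2 \<eta>\<^sub>n = \<sigma>\<^sup>2 q\<^sup>2 / \<mu>\<close>. After multiplication by
  \<open>N + 1\<close> these inequalities telescope, the noise adds up to \<open>\<sigma>\<^sup>2 / \<mu>\<close> times a harmonic sum, which
  the logarithm dominates, and \<open>E\<^sub>0\<close> is the initial quantity of the theorem because \<open>v\<^sub>0 = 0\<close>.

  In the contraction, the gradient step lowers \<open>f\<close>, the strong convexity inequality towards \<open>\<pi> x\<^sub>n'\<close>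
  bounds the terms with \<open>x\<^sub>n' - \<pi> x\<^sub>n'\<close>, and the weak convexity inequality between \<open>x\<^sub>n\<close> and \<open>x\<^sub>n'\<close>
  bounds the terms with \<open>v\<^sub>n\<close>. For a constant step size, \<open>\<alpha>\<^sub>n = 1\<close> makes all coefficients match.
  Here they do not match: the update uses \<open>\<eta>\<^sub>n\<close>, but \<open>x\<^sub>n' - x\<^sub>n\<close> contains \<open>\<eta>\<^sub>n\<^sub>-\<^sub>1\<close>, and with
  \<open>\<alpha>\<^sub>n = 1\<close> a positive multiple \<open>q (1 - q)\<close> of \<open>f x\<^sub>n' - inf f\<close> would remain. The coefficient used below
  is \<open>\<alpha>\<^sub>n = 1 + p / 2 + O(p\<^sup>2)\<close> with \<open>p = 1 / N\<close>; it is the one for which one step turns the normal vector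
  into \<open>(1 - q / 2) R v\<^sub>n + u - (1 + q / 2) sqrt \<eta>\<^sub>n R g\<^sub>n\<close>, where \<open>u = sqrt \<mu> (x\<^sub>n' - \<pi> x\<^sub>n')\<close>. No
  deficit of first order in \<open>q\<close> is then left, and the values of \<open>f\<close> at \<open>x\<^sub>n\<close> and \<open>x\<^sub>n'\<close> are left with
  coefficients of order \<open>q\<^sup>2\<close> and of the good sign. By quadratic growth (\<open>quadratic_growth\<close>) these values
  dominate squared distances to the minimizers, and that is enough to make the remaining quadratic
  form in \<open>R v\<^sub>n\<close> and \<open>u\<close> nonnegative when \<open>N \<ge> 2\<close> (\<open>quadratic_form_nonneg\<close>). Since quadratic growth and
  the Lipschitz bound force \<open>\<mu> \<le> L\<close>, this covers every \<open>n \<ge> 1\<close>; for \<open>n = 0\<close> the velocity vanishes.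

  The probabilistic input is that \<open>(x\<^sub>n, v\<^sub>n)\<close> is a function of \<open>x\<^sub>0\<close> and \<open>\<omega>\<^sub>0, \<dots>, \<omega>\<^sub>n\<^sub>-\<^sub>1\<close>, hence
  independent of \<open>\<omega>\<^sub>n\<close>, so that the expectation over \<open>\<omega>\<^sub>n\<close> can be taken with \<open>(x\<^sub>n, v\<^sub>n)\<close> fixed
  (\<open>nn_integral_fresh\<close>). Expected energies are integrals of nonnegative functions with values in
  \<open>[0, \<infinity>]\<close>, so an initial energy of infinite expectation needs no separate treatment.
\<close>

section \<open>Orthogonal projections\<close>

lemma orthogonal_projection_unique:
  assumes "subspace V" "is_orthogonal_projection V P" "w \<in> V" "\<And>v. v \<in> V \<Longrightarrow> inner (y - w) v = 0"
  shows "P y = w"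
proof -
  have Py: "P y \<in> V" "\<And>v. v \<in> V \<Longrightarrow> inner (y - P y) v = 0"
    using assms(2) by (auto simp: is_orthogonal_projection_def)
  have d: "w - P y \<in> V"
    using assms(1,3) Py(1) by (rule subspace_diff)
  have "inner (w - P y) (w - P y) = inner (y - P y) (w - P y) - inner (y - w) (w - P y)"
    by (simp add: inner_diff_left)
  also have "\<dots> = 0"
    using Py(2)[OF d] assms(4)[OF d] by simp
  finally show ?thesis by simp
qed

lemma linear_orthogonal_projection:
  assumes V: "subspace V" and P: "is_orthogonal_projection V P"
  shows "linear P"
proof -
  have P_in: "P y \<in> V" for y
    using P by (auto simp: is_orthogonal_projection_def)
  have P_orth: "v \<in> V \<Longrightarrow> inner (y - P y) v = 0" for y v
    using P by (auto simp: is_orthogonal_projection_def)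
  show ?thesis
  proof (rule linearI)
    fix y z
    have eq: "y + z - (P y + P z) = (y - P y) + (z - P z)" by simp
    show "P (y + z) = P y + P z"
      by (rule orthogonal_projection_unique[OF V P])
        (simp_all only: eq inner_add_left P_orth subspace_add[OF V P_in P_in] add_0)
  next
    fix c y
    have eq: "c *\<^sub>R y - c *\<^sub>R P y = c *\<^sub>R (y - P y)" by (simp add: scaleR_diff_right)
    show "P (c *\<^sub>R y) = c *\<^sub>R P y"
      by (rule orthogonal_projection_unique[OF V P])
        (simp_all only: eq inner_scaleR_left P_orth subspace_scale[OF V P_in] mult_zero_right)
  qed
qed

section \<open>Two one-dimensional estimates\<close>

text \<open>
  By the Cauchy-Schwarz inequality and the Lipschitz bound, \<open>f\<close> minus the asserted upper bound is
  nonincreasing along the segment from \<open>y\<close> to \<open>y + u\<close>.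
\<close>

lemma descent_lemma:
  fixes f :: "'a::real_inner \<Rightarrow> real"
  assumes grad: "\<And>y. GDERIV f y :> grad y" and lip: "L-lipschitz_on UNIV grad"
  shows "f (y + u) \<le> f y + inner (grad y) u + L / 2 * (norm u)\<^sup>2"
proof -
  define h where "h t = f (y + t *\<^sub>R u) - t * inner (grad y) u - L / 2 * t\<^sup>2 * (norm u)\<^sup>2" for t :: real
  have der: "(h has_real_derivative
      (inner (grad (y + t *\<^sub>R u)) u - inner (grad y) u - L * t * (norm u)\<^sup>2)) (at t)" for t
  proof -
    have "(f has_derivative (\<lambda>k. inner k (grad (y + t *\<^sub>R u)))) (at (y + t *\<^sub>R u))"
      using grad by (simp add: gderiv_def)
    then have "((\<lambda>t. f (y + t *\<^sub>R u)) has_derivative (\<lambda>k. inner (k *\<^sub>R u) (grad (y + t *\<^sub>R u)))) (at t)"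
      by (rule has_derivative_compose[rotated]) (auto intro!: derivative_eq_intros)
    then have "((\<lambda>t. f (y + t *\<^sub>R u)) has_real_derivative inner (grad (y + t *\<^sub>R u)) u) (at t)"
      by (simp add: has_field_derivative_def inner_commute mult_commute_abs)
    then show ?thesis
      unfolding h_def by (auto intro!: derivative_eq_intros)
  qed
  have "h 1 \<le> h 0"
  proof (rule DERIV_nonpos_imp_nonincreasing[of 0 1 h])
    fix t :: real assume t: "0 \<le> t" "t \<le> 1"
    have "inner (grad (y + t *\<^sub>R u) - grad y) u \<le> norm (grad (y + t *\<^sub>R u) - grad y) * norm u"
      by (rule norm_cauchy_schwarz)
    also have "\<dots> \<le> (L * norm (t *\<^sub>R u)) * norm u"
      using lipschitz_onD[OF lip, of "y + t *\<^sub>R u" y]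
      by (intro mult_right_mono) (auto simp: dist_norm)
    also have "\<dots> = L * t * (norm u)\<^sup>2"
      using t by (simp add: power2_eq_square)
    finally have "inner (grad (y + t *\<^sub>R u)) u - inner (grad y) u - L * t * (norm u)\<^sup>2 \<le> 0"
      by (simp add: inner_diff_left)
    then show "\<exists>D. DERIV h t :> D \<and> D \<le> 0"
      using der by blast
  qed simp
  then show ?thesis by (simp add: h_def)
qed

text \<open>
  The differential inequality says that \<open>\<phi> t / t - k * t\<close> is nondecreasing. As \<open>\<phi>\<close> is nonnegative, this
  function is at least \<open>- k * t\<close>, which tends to zero with \<open>t\<close>, so its value at one is nonnegative.
\<close>

lemma quadratic_growth_along_ray:
  fixes \<phi> \<phi>' :: "real \<Rightarrow> real"
  assumes der: "\<And>t. 0 < t \<Longrightarrow> (\<phi> has_real_derivative \<phi>' t) (at t)"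
    and star: "\<And>t. 0 < t \<Longrightarrow> t * \<phi>' t \<ge> \<phi> t + k * t\<^sup>2"
    and nonneg: "\<And>t. \<phi> t \<ge> 0"
  shows "\<phi> 1 \<ge> k"
proof (rule ccontr)
  assume "\<not> ?thesis"
  then have k: "\<phi> 1 < k" by simp
  then have kpos: "0 < k" using nonneg[of 1] by linarith
  define \<psi> where "\<psi> t = \<phi> t / t - k * t" for t
  have mono: "\<psi> s \<le> \<psi> 1" if s: "0 < s" "s \<le> 1" for s
  proof (rule DERIV_nonneg_imp_nondecreasing[OF s(2)])
    fix t assume t: "s \<le> t" "t \<le> 1"
    then have t0: "0 < t" using s by simp
    have "(\<psi> has_real_derivative (\<phi>' t * t - \<phi> t * 1) / (t * t) - k * 1) (at t)"
      unfolding \<psi>_def using t0 der[OF t0] by (auto intro!: derivative_eq_intros)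
    moreover have "(\<phi>' t * t - \<phi> t * 1) / (t * t) - k * 1 \<ge> 0"
      using star[OF t0] t0 by (simp add: field_simps power2_eq_square)
    ultimately show "\<exists>D. DERIV \<psi> t :> D \<and> 0 \<le> D" by blast
  qed
  \<comment> \<open>A time at which the lower bound \<open>- k * s\<close> already exceeds the supposed value \<open>\<phi> 1 - k\<close>.\<close>
  define s where "s = (k - \<phi> 1) / (2 * k)"
  have s: "0 < s" "s \<le> 1" "k * s = (k - \<phi> 1) / 2"
    using k kpos nonneg[of 1] by (auto simp: s_def field_simps)
  have "- (k * s) \<le> \<psi> s" using nonneg[of s] s by (simp add: \<psi>_def)
  also have "\<dots> \<le> \<phi> 1 - k" using mono[OF s(1,2)] by (simp add: \<psi>_def)
  finally have "k - \<phi> 1 \<le> (k - \<phi> 1) / 2" using s(3) by argo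
  then show False using k by argo
qed

section \<open>Functions with an affine set of minimizers\<close>

locale affine_minimizers =
  fixes f :: "real ^ 'd \<Rightarrow> real" and grad :: "real ^ 'd \<Rightarrow> real ^ 'd"
    and V :: "(real ^ 'd) set" and P :: "real ^ 'd \<Rightarrow> real ^ 'd" and xstar :: "real ^ 'd"
    and L \<mu> \<epsilon> :: real
  assumes grad: "\<And>y. GDERIV f y :> grad y"
    and L_pos: "L > 0" and lip: "L-lipschitz_on UNIV grad"
    and bdd: "bdd_below (range f)"
    and mu_pos: "\<mu> > 0"
    and V: "subspace V" and dim_V: "dim V < CARD('d)"
    and P: "is_orthogonal_projection V P"
    and minimizers_eq: "minimizers f = {xstar + u |u. u \<in> V}"
    and xstar_min: "\<And>y. y \<in> minimizers f \<Longrightarrow> norm xstar \<le> norm y"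
    and strong: "\<And>y. inner (grad y) (y - (P y + xstar)) \<ge>
          f y - f (P y + xstar) + \<mu> / 2 * (norm (y - (P y + xstar)))\<^sup>2"
    and weak: "\<And>y u. inner (grad (y + u)) u \<ge> f (y + u) - f y - \<epsilon> / 2 * (norm u)\<^sup>2"
    and eps: "\<epsilon> \<le> sqrt (\<mu> / step_size L \<mu> 0)"
begin

definition gap :: "real ^ 'd \<Rightarrow> real" where
  "gap y = f y - (INF z. f z)"

definition normal :: "real ^ 'd \<Rightarrow> real ^ 'd" where
  "normal y = y - P y"

definition offset :: "real ^ 'd \<Rightarrow> real ^ 'd" where
  "offset y = y - (P y + xstar)"

lemma linear_P: "linear P"
  by (rule linear_orthogonal_projection[OF V P])

lemma P_in: "P y \<in> V"
  using P by (auto simp: is_orthogonal_projection_def)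

lemma P_of_V: "y \<in> V \<Longrightarrow> P y = y"
  by (rule orthogonal_projection_unique[OF V P]) auto

lemma inner_P_normal: "inner (P y) (normal z) = 0"
  using P P_in by (auto simp: is_orthogonal_projection_def normal_def inner_commute)

lemma linear_normal: "linear normal"
  unfolding normal_def[abs_def] by (intro linear_compose_sub linear_P linear_ident)

lemma gap_nonneg: "gap y \<ge> 0"
  using cINF_lower[OF bdd, of y] by (simp add: gap_def)

lemma norm_P_normal: "(norm y)\<^sup>2 = (norm (P y))\<^sup>2 + (norm (normal y))\<^sup>2"
proof -
  have "y = P y + normal y" by (simp add: normal_def)
  then have "(norm y)\<^sup>2 = (norm (P y + normal y))\<^sup>2" by simp
  also have "\<dots> = (norm (P y))\<^sup>2 + (norm (normal y))\<^sup>2"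
    by (simp add: norm_add_Pythagorean orthogonal_def inner_P_normal)
  finally show ?thesis .
qed

lemma inner_normal: "inner (normal y) z = inner (normal y) (normal z)"
proof -
  have "z = P z + normal z" by (simp add: normal_def)
  then have "inner (normal y) z = inner (normal y) (P z + normal z)" by simp
  then show ?thesis by (simp add: inner_add_right inner_commute inner_P_normal)
qed

lemma inner_P: "inner (P y) z = inner (P y) (P z)"
proof -
  have "z = P z + normal z" by (simp add: normal_def)
  then have "inner (P y) z = inner (P y) (P z + normal z)" by simp
  then show ?thesis by (simp add: inner_add_right inner_P_normal)
qed

text \<open>
  Removing the tangential part of \<open>xstar\<close> gives another minimizer, whose norm is strictly smaller unless
  that part is zero.
\<close>

lemma P_xstar: "P xstar = 0"
proof -
  have "normal xstar = xstar + (- P xstar)" by (simp add: normal_def)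
  then have "normal xstar \<in> minimizers f"
    using subspace_neg[OF V P_in] by (auto simp: minimizers_eq)
  then have "(norm xstar)\<^sup>2 \<le> (norm (normal xstar))\<^sup>2"
    using xstar_min by (intro power_mono) auto
  then show ?thesis using norm_P_normal[of xstar] by simp
qed

lemma P_offset: "P (offset y) = 0"
  using linear_P P_xstar P_of_V[OF P_in]
  by (simp add: offset_def linear_diff linear_add)

lemma normal_offset: "normal (offset y) = offset y"
  by (simp add: normal_def P_offset)

lemma offset_add: "offset (y + u) = offset y + normal u"
  using linear_P by (simp add: offset_def normal_def linear_add)

lemma gap_minimizer: "w \<in> V \<Longrightarrow> gap (w + xstar) = 0"
proof -
  assume "w \<in> V"
  then have "w + xstar \<in> minimizers f" unfolding minimizers_eq by (auto intro!: exI[of _ w])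
  then show ?thesis by (simp add: minimizers_def gap_def)
qed

lemma strong_gap: "inner (grad y) (offset y) \<ge> gap y + \<mu> / 2 * (norm (offset y))\<^sup>2"
  using strong[of y] gap_minimizer[OF P_in, of y] by (simp add: gap_def offset_def)

lemma weak_gap: "inner (grad (y + u)) u \<ge> gap (y + u) - gap y - \<epsilon> / 2 * (norm u)\<^sup>2"
  using weak[of y u] by (simp add: gap_def)

lemma descent_gap: "gap (y + u) \<le> gap y + inner (grad y) u + L / 2 * (norm u)\<^sup>2"
  using descent_lemma[OF grad lip, of y u] by (simp add: gap_def)

text \<open>
  On the ray from the projection of \<open>y\<close> through \<open>y\<close> all points have the same projection, so the strong
  convexity inequality becomes a differential inequality for \<open>f\<close> along that ray.
\<close>

lemma quadratic_growth: "gap y \<ge> \<mu> / 2 * (norm (offset y))\<^sup>2"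
proof -
  define c where "c = P y + xstar"
  define \<gamma> where "\<gamma> t = c + t *\<^sub>R offset y" for t :: real
  have off: "offset (\<gamma> t) = t *\<^sub>R offset y" for t
  proof -
    have "offset c = 0"
      using linear_P P_xstar P_of_V[OF P_in] by (simp add: c_def offset_def linear_add)
    then show ?thesis
      unfolding \<gamma>_def offset_add using linear_normal by (simp add: linear_scale normal_offset)
  qed
  have "gap (\<gamma> 1) \<ge> \<mu> / 2 * (norm (offset y))\<^sup>2"
  proof (rule quadratic_growth_along_ray[where \<phi> = "\<lambda>t. gap (\<gamma> t)"
        and \<phi>' = "\<lambda>t. inner (grad (\<gamma> t)) (offset y)"])
    fix t :: real
    have "(f has_derivative (\<lambda>k. inner k (grad (\<gamma> t)))) (at (\<gamma> t))"
      using grad by (simp add: gderiv_def)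
    then have "((\<lambda>t. f (\<gamma> t)) has_derivative (\<lambda>k. inner (k *\<^sub>R offset y) (grad (\<gamma> t)))) (at t)"
      unfolding \<gamma>_def
      by (rule has_derivative_compose[rotated]) (auto intro!: derivative_eq_intros)
    then have "((\<lambda>t. f (\<gamma> t)) has_real_derivative inner (grad (\<gamma> t)) (offset y)) (at t)"
      by (simp add: has_field_derivative_def inner_commute mult_commute_abs)
    then show "((\<lambda>t. gap (\<gamma> t)) has_real_derivative inner (grad (\<gamma> t)) (offset y)) (at t)"
      unfolding gap_def by (auto intro!: derivative_eq_intros)
    show "gap (\<gamma> t) + \<mu> / 2 * (norm (offset y))\<^sup>2 * t\<^sup>2 \<le> t * inner (grad (\<gamma> t)) (offset y)"
      using strong_gap[of "\<gamma> t"] by (simp add: off power_mult_distrib mult_ac)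
  qed (rule gap_nonneg)
  then show ?thesis by (simp add: \<gamma>_def c_def offset_def)
qed

text \<open>
  Otherwise a gradient step of length \<open>1 / L\<close> would lead below the infimum.
\<close>

lemma grad_minimizer: "gap y = 0 \<Longrightarrow> grad y = 0"
proof -
  assume y: "gap y = 0"
  have "0 \<le> gap (y + (- (1 / L)) *\<^sub>R grad y)" by (rule gap_nonneg)
  also have "\<dots> \<le> - (1 / (2 * L)) * (norm (grad y))\<^sup>2"
  proof -
    have "L / 2 * (norm ((- (1 / L)) *\<^sub>R grad y))\<^sup>2 = 1 / (2 * L) * (norm (grad y))\<^sup>2"
      using L_pos by (simp add: power_divide power2_eq_square)
    moreover have "inner (grad y) ((- (1 / L)) *\<^sub>R grad y) = - (1 / L) * (norm (grad y))\<^sup>2"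
      by (simp add: power2_norm_eq_inner)
    moreover have "- (1 / L) * (norm (grad y))\<^sup>2 + 1 / (2 * L) * (norm (grad y))\<^sup>2
        = - (1 / (2 * L)) * (norm (grad y))\<^sup>2"
      using L_pos by (simp add: field_simps)
    ultimately show ?thesis
      using descent_gap[of y "(- (1 / L)) *\<^sub>R grad y"] y by linarith
  qed
  finally have "(norm (grad y))\<^sup>2 \<le> 0"
    using L_pos by (simp add: field_simps)
  then show ?thesis by simp
qed

text \<open>
  Normal to the minimizers, \<open>f\<close> grows at least like \<open>\<mu> / 2\<close> and, since the gradient vanishes at
  \<open>xstar\<close>, at most like \<open>L / 2\<close> times the squared distance. A normal direction exists because \<open>V\<close> is a
  proper subspace.
\<close>

lemma mu_le_L: "\<mu> \<le> L"
proof -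
  have "V \<noteq> UNIV" using dim_V by (auto simp: dim_UNIV)
  then obtain y where y: "y \<notin> V" by auto
  define u where "u = normal y"
  have u0: "u \<noteq> 0" using y P_in[of y] by (auto simp: u_def normal_def)
  have "offset (xstar + u) = u"
    unfolding offset_add using linear_P P_of_V[OF P_in]
    by (simp add: offset_def P_xstar u_def normal_def linear_diff)
  then have "\<mu> / 2 * (norm u)\<^sup>2 \<le> gap (xstar + u)"
    using quadratic_growth[of "xstar + u"] by simp
  also have "\<dots> \<le> L / 2 * (norm u)\<^sup>2"
    using descent_gap[of xstar u] gap_minimizer[OF subspace_0[OF V]] grad_minimizer[of xstar] by simp
  finally show ?thesis using u0 by simp
qed

end

section \<open>A quadratic form\<close>

text \<open>
  The two sides agree to first order in \<open>q\<close>, so their second order terms decide. The variables stand for \<open>A = |R v|\<^sup>2\<close>, \<open>B = \<langle>R v, u\<rangle>\<close> and \<open>C = |u|\<^sup>2\<close>, of which the hypothesis on all \<open>r\<close>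
  records the Cauchy-Schwarz inequality in the form \<open>|u + r R v|\<^sup>2 \<ge> 0\<close>. The last two summands on the
  right come from quadratic growth at \<open>x'\<close> and at \<open>x\<close>. The coefficient of \<open>C\<close> in the difference of the
  two sides is exactly \<open>q\<^sup>2\<close>; completing the square leaves a multiple of \<open>A\<close>, whose coefficient is
  nonnegative for \<open>N \<ge> 2\<close>.
\<close>

lemma quadratic_form_nonneg:
  fixes A B C N :: real
  assumes N: "N \<ge> 2" and AC: "\<And>r. 0 \<le> C + 2 * r * B + r\<^sup>2 * A" and A: "A \<ge> 0"
  defines "q \<equiv> 1 / (N + 1)" and "p \<equiv> 1 / N"
  shows "(1 - q / 2)\<^sup>2 * A + 2 * (1 - q / 2) * B + C + q * (1 - q\<^sup>2 / 4) * A
    \<le> (1 - q) * (((1 - p / 2 + p\<^sup>2 / 2) / (1 - p))\<^sup>2 * A + 2 * ((1 - p / 2 + p\<^sup>2 / 2) / (1 - p)) * B + C)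
      + q * (1 + q / 2) * C + (q\<^sup>2 / 4 + q^3 / 4) * C + (1 - q) * (q\<^sup>2 / 4) * (C - 2 * p * B + p\<^sup>2 * A)"
proof -
  define al where "al = (1 - p / 2 + p\<^sup>2 / 2) / (1 - p)"
  have al: "al = (2 * N\<^sup>2 - N + 1) / (2 * N * (N - 1))"
    using N unfolding al_def p_def by (simp add: divide_simps power2_eq_square) algebra
  define X where "X = (1 - q) * al - (1 - q / 2) - (1 - q) * (q\<^sup>2 / 4) * p"
  define W where "W = (1 - q) * al\<^sup>2 - (1 - q / 2)\<^sup>2 - q * (1 - q\<^sup>2 / 4) + (1 - q) * (q\<^sup>2 / 4) * p\<^sup>2"
  have q: "0 < q" "q < 1" "0 < p" using N by (auto simp: q_def p_def)
  have "(1 - q) * al - (1 - q / 2) = 1 / ((N - 1) * (N + 1))"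
    using N unfolding al q_def by (simp add: divide_simps) algebra
  moreover have "(1 - q) * (q\<^sup>2 / 4) * p = 1 / (4 * (N + 1)^3)"
    using N unfolding p_def q_def by (simp add: divide_simps power2_eq_square power3_eq_cube)
  ultimately have X: "X = 1 / ((N - 1) * (N + 1)) - 1 / (4 * (N + 1)^3)"
    by (simp add: X_def)
  have "1 / (4 * (N + 1)^3) \<le> 1 / ((N - 1) * (N + 1))"
  proof (rule divide_left_mono)
    have "(N - 1) * (N + 1) \<le> (4 * (N + 1) * (N + 1)) * (N + 1)"
      using N by (intro mult_right_mono) (auto simp: algebra_simps)
    then show "(N - 1) * (N + 1) \<le> 4 * (N + 1)^3"
      by (simp add: power3_eq_cube mult_ac)
  qed (use N in auto)
  then have X_bounds: "0 \<le> X" "X \<le> 1 / ((N - 1) * (N + 1))"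
    using N by (auto simp: X)
  have "(X / q)\<^sup>2 \<le> (1 / (N - 1))\<^sup>2"
  proof (rule power_mono)
    have "X / q \<le> 1 / ((N - 1) * (N + 1)) / q"
      using X_bounds q by (intro divide_right_mono) auto
    also have "\<dots> = 1 / (N - 1)" using N by (simp add: q_def)
    finally show "X / q \<le> 1 / (N - 1)" .
  qed (use X_bounds q in auto)
  also have "\<dots> \<le> (1 / (N - 1))\<^sup>2 + (4 * N^3 - 3 * N\<^sup>2 - 10 * N + 1) / (4 * N * (N + 1)\<^sup>2 * (N - 1)\<^sup>2)"
  proof -
    have "4 * N^3 - 3 * N\<^sup>2 - 10 * N + 1 = (N - 2) * (4 * N\<^sup>2 + 5 * N) + 1"
      by (simp add: algebra_simps power2_eq_square power3_eq_cube)
    then show ?thesis using N by simp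
  qed
  also have "\<dots> = (1 - q) * al\<^sup>2 - (1 - q / 2)\<^sup>2 - q"
  proof -
    have "(1 - q) * al\<^sup>2 = (2 * N\<^sup>2 - N + 1)\<^sup>2 / (4 * N * (N + 1) * (N - 1)\<^sup>2)"
      using N unfolding al q_def by (simp add: power_divide power_mult_distrib divide_simps power2_eq_square)
    moreover have "(1 - q / 2)\<^sup>2 = (2 * N + 1)\<^sup>2 / (4 * (N + 1)\<^sup>2)"
      using N unfolding q_def by (simp add: power_divide divide_simps) algebra
    ultimately show ?thesis
      using N unfolding q_def by (simp add: divide_simps) algebra
  qed
  also have "\<dots> \<le> W"
    using q by (simp add: W_def algebra_simps)
  finally have W: "(X / q)\<^sup>2 \<le> W" .
  have "0 \<le> q\<^sup>2 * (C + 2 * (X / q\<^sup>2) * B + (X / q\<^sup>2)\<^sup>2 * A) + (W - (X / q)\<^sup>2) * A"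
    using AC[of "X / q\<^sup>2"] W A by simp
  also have "\<dots> = q\<^sup>2 * C + 2 * X * B + W * A"
    using q by (simp add: power_divide field_simps power2_eq_square)
  also have "q\<^sup>2 * C = (1 - q) * C + q * (1 + q / 2) * C + (q\<^sup>2 / 4 + q^3 / 4) * C
      + (1 - q) * (q\<^sup>2 / 4) * C - C"
    by (simp add: field_simps power2_eq_square power3_eq_cube)
  finally show ?thesis
    unfolding al_def[symmetric] X_def W_def
    by (simp add: algebra_simps diff_divide_distrib add_divide_distrib)
qed

section \<open>Decay of the energy in one step\<close>

lemma step_size_nat:
  fixes n :: nat and L \<mu> :: real
  assumes "\<mu> > 0" "L > 0"
  defines "q \<equiv> 1 / (real n + sqrt (L / \<mu>) + 1)"
  shows "step_size L \<mu> (int n) = q\<^sup>2 / \<mu>" "sqrt (step_size L \<mu> (int n)) = q / sqrt \<mu>"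
    "momentum L \<mu> (int n) = (1 - q) / (1 + q)"
proof -
  have q: "q > 0" using assms by (auto simp: q_def intro!: divide_pos_pos add_nonneg_pos)
  show *: "step_size L \<mu> (int n) = q\<^sup>2 / \<mu>"
    by (simp add: step_size_def q_def power_divide mult.commute)
  show "sqrt (step_size L \<mu> (int n)) = q / sqrt \<mu>"
    unfolding * using q by (simp add: real_sqrt_divide)
  have "sqrt (\<mu> * step_size L \<mu> (int n)) = q"
    unfolding * using q assms(1) by simp
  then show "momentum L \<mu> (int n) = (1 - q) / (1 + q)"
    by (simp add: momentum_def)
qed

lemma sqrt_step_size_pred:
  assumes "\<mu> > 0" "L > 0"
  shows "sqrt (step_size L \<mu> (int n - 1)) = 1 / (real n + sqrt (L / \<mu>)) / sqrt \<mu>"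
proof -
  have "step_size L \<mu> (int n - 1) = (1 / (real n + sqrt (L / \<mu>)))\<^sup>2 / \<mu>"
    by (simp add: step_size_def power_divide mult.commute)
  then show ?thesis
    using assms by (simp add: real_sqrt_divide)
qed

lemma norm_diff_scaled_square:
  fixes a b :: "'a::real_inner"
  shows "(norm (a - r *\<^sub>R b))\<^sup>2 = (norm a)\<^sup>2 - 2 * r * inner a b + r\<^sup>2 * (norm b)\<^sup>2"
  unfolding power2_norm_eq_inner
  by (simp add: inner_diff_left inner_diff_right inner_commute power2_eq_square algebra_simps)

context affine_minimizers
begin

text \<open>
  The time parameter \<open>N = n + shift\<close> of iteration \<open>n\<close> determines all step sizes, so the scheme and the
  energy are written in terms of the real number \<open>N\<close>. A state is a pair of position and velocity.
\<close>

definition shift :: real where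
  "shift = sqrt (L / \<mu>)"

definition lookahead :: "real \<Rightarrow> (real ^ 'd) \<times> (real ^ 'd) \<Rightarrow> real ^ 'd" where
  "lookahead N z = fst z + (1 / N / sqrt \<mu>) *\<^sub>R snd z"

definition step :: "real \<Rightarrow> (real ^ 'd) \<times> (real ^ 'd) \<Rightarrow> real ^ 'd \<Rightarrow> (real ^ 'd) \<times> (real ^ 'd)" where
  "step N z \<gamma> = (let q = 1 / (N + 1) in
     (lookahead N z - (q\<^sup>2 / \<mu>) *\<^sub>R \<gamma>, ((1 - q) / (1 + q)) *\<^sub>R (snd z - (q / sqrt \<mu>) *\<^sub>R \<gamma>)))"

text \<open>
  The denominators vanish for \<open>N = 1\<close>, which can occur only at \<open>n = 0\<close>; there the coefficients multiply
  the zero velocity.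
\<close>

definition energy :: "real \<Rightarrow> (real ^ 'd) \<times> (real ^ 'd) \<Rightarrow> real" where
  "energy N z = (let p = 1 / N in gap (fst z)
     + (norm (((1 - p / 2 + p\<^sup>2 / 2) / (1 - p)) *\<^sub>R normal (snd z) + sqrt \<mu> *\<^sub>R offset (lookahead N z)))\<^sup>2 / 2
     + (1 - p\<^sup>2 / 4) * ((1 + p) / (1 - p))\<^sup>2 * (norm (P (snd z)))\<^sup>2 / 2)"

lemma shift: "shift \<ge> 1" "shift\<^sup>2 = L / \<mu>"
  using mu_le_L mu_pos L_pos by (auto simp: shift_def)

text \<open>
  For a given sample \<open>\<gamma>\<close> in place of the gradient, the new energy is bounded by a quadratic polynomial
  in \<open>\<gamma>\<close> whose expectation needs only the mean and the variance of \<open>\<gamma>\<close>. The coefficients of the energy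
  are made for this computation: \<open>theta\<close> below is the identity that determines \<open>\<alpha>\<close>, and the
  coefficients of the normal and of the tangential part of \<open>v\<close> in the inner product with \<open>\<gamma>\<close> agree, as
  \<open>(1 + q / 2) * (1 - q / 2) = 1 - q\<^sup>2 / 4\<close>, so that the gradient meets the full velocity.
\<close>

lemma energy_step:
  fixes z :: "(real ^ 'd) \<times> (real ^ 'd)"
  assumes N: "N \<ge> shift"
  defines "q \<equiv> 1 / (N + 1)"
  defines "s \<equiv> q / sqrt \<mu>"
  defines "y \<equiv> lookahead N z"
  defines "w \<equiv> (1 - q / 2) *\<^sub>R normal (snd z) + sqrt \<mu> *\<^sub>R offset y"
  shows "energy (N + 1) (step N z \<gamma>) \<le>
    gap y + (norm w)\<^sup>2 / 2 + (1 - q\<^sup>2 / 4) * (norm (P (snd z)))\<^sup>2 / 2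
    - inner (s\<^sup>2 *\<^sub>R grad y + ((1 + q / 2) * s) *\<^sub>R w + (s * (1 - q\<^sup>2 / 4)) *\<^sub>R P (snd z)) \<gamma>
    + s\<^sup>2 * (norm \<gamma>)\<^sup>2"
proof -
  define v where "v = snd z"
  define K where "K = 1 + q / 2"
  define \<rho> where "\<rho> = (1 - q) / (1 + q)"
  define \<alpha> where "\<alpha> = (1 - q / 2 + q\<^sup>2 / 2) / (1 - q)"
  define x1 where "x1 = y - s\<^sup>2 *\<^sub>R \<gamma>"
  define v1 where "v1 = \<rho> *\<^sub>R (v - s *\<^sub>R \<gamma>)"
  have N1: "N \<ge> 1" using N shift by simp
  have q: "0 < q" "q \<le> 1 / 2" using N1 by (auto simp: q_def field_simps)
  have s: "s\<^sup>2 = q\<^sup>2 / \<mu>" "sqrt \<mu> * s = q" "s > 0"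
    using mu_pos q by (auto simp: s_def power_divide)
  have step: "step N z \<gamma> = (x1, v1)"
    by (simp add: step_def Let_def x1_def v1_def s q_def[symmetric] y_def[symmetric]
        s_def[symmetric] \<rho>_def v_def)
  have "(\<alpha> + q) * \<rho> = 1 - q / 2"
  proof -
    have "\<alpha> + q = (1 + q) * (1 - q / 2) / (1 - q)"
      using q by (simp add: \<alpha>_def divide_simps power2_eq_square) algebra
    then show ?thesis using q by (simp add: \<rho>_def)
  qed
  then have theta: "\<alpha> * \<rho> + q * \<rho> = 1 - q / 2" by (simp add: algebra_simps)
  have normal_v1: "normal v1 = \<rho> *\<^sub>R normal v - (\<rho> * s) *\<^sub>R normal \<gamma>"
    using linear_normal by (simp add: v1_def linear_scale linear_diff scaleR_diff_right)
  have "offset (lookahead (N + 1) (x1, v1)) = offset (y + (s *\<^sub>R v1 - s\<^sup>2 *\<^sub>R \<gamma>))"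
    by (simp add: lookahead_def x1_def s_def q_def algebra_simps)
  also have "\<dots> = offset y + s *\<^sub>R normal v1 - s\<^sup>2 *\<^sub>R normal \<gamma>"
    unfolding offset_add using linear_normal by (simp add: linear_scale linear_diff)
  finally have off: "offset (lookahead (N + 1) (x1, v1)) = offset y + s *\<^sub>R normal v1 - s\<^sup>2 *\<^sub>R normal \<gamma>" .
  have "\<alpha> *\<^sub>R normal v1 + sqrt \<mu> *\<^sub>R offset (lookahead (N + 1) (x1, v1))
      = \<alpha> *\<^sub>R normal v1 + sqrt \<mu> *\<^sub>R offset y + (sqrt \<mu> * s) *\<^sub>R normal v1 - (sqrt \<mu> * s * s) *\<^sub>R normal \<gamma>"
    unfolding off by (simp add: algebra_simps power2_eq_square)
  also have "\<dots> = (\<alpha> * \<rho> + q * \<rho>) *\<^sub>R normal v + sqrt \<mu> *\<^sub>R offset y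
      - ((\<alpha> * \<rho> + q * \<rho> + q) * s) *\<^sub>R normal \<gamma>"
    unfolding s(2) by (simp add: normal_v1 algebra_simps)
  also have "\<dots> = w - (K * s) *\<^sub>R normal \<gamma>"
    by (simp add: theta w_def v_def K_def)
  finally have nrm: "(norm (\<alpha> *\<^sub>R normal v1 + sqrt \<mu> *\<^sub>R offset (lookahead (N + 1) (x1, v1))))\<^sup>2
      = (norm w)\<^sup>2 - 2 * (K * s) * inner w (normal \<gamma>) + (K * s)\<^sup>2 * (norm (normal \<gamma>))\<^sup>2"
    by (simp add: norm_diff_scaled_square)
  have w_normal: "w = normal w"
    unfolding w_def using linear_normal
    by (simp add: linear_add linear_scale normal_offset) (simp add: normal_def P_of_V[OF P_in] linear_P linear_diff)
  then have inner_w: "inner w (normal \<gamma>) = inner w \<gamma>"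
    using inner_normal by metis
  \<comment> \<open>The tangential weight of the energy cancels the square of the momentum.\<close>
  have "P v1 = \<rho> *\<^sub>R (P v - s *\<^sub>R P \<gamma>)"
    using linear_P by (simp add: v1_def linear_scale linear_diff)
  then have "(norm (P v1))\<^sup>2 = \<rho>\<^sup>2 * (norm (P v - s *\<^sub>R P \<gamma>))\<^sup>2"
    by (simp add: power_mult_distrib)
  moreover have "((1 + q) / (1 - q))\<^sup>2 * \<rho>\<^sup>2 = 1"
    using q by (simp add: \<rho>_def flip: power_mult_distrib)
  ultimately have "((1 + q) / (1 - q))\<^sup>2 * (norm (P v1))\<^sup>2 = (norm (P v - s *\<^sub>R P \<gamma>))\<^sup>2"
    by (simp flip: mult.assoc)
  then have tng: "((1 + q) / (1 - q))\<^sup>2 * (norm (P v1))\<^sup>2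
      = (norm (P v))\<^sup>2 - 2 * s * inner (P v) \<gamma> + s\<^sup>2 * (norm (P \<gamma>))\<^sup>2"
    by (simp add: norm_diff_scaled_square inner_P[of v \<gamma>])
  have "gap x1 \<le> gap y + inner (grad y) (- (s\<^sup>2 *\<^sub>R \<gamma>)) + L / 2 * (norm (- (s\<^sup>2 *\<^sub>R \<gamma>)))\<^sup>2"
    using descent_gap[of y "- (s\<^sup>2 *\<^sub>R \<gamma>)"] by (simp add: x1_def)
  also have "\<dots> = gap y - s\<^sup>2 * inner (grad y) \<gamma> + s\<^sup>2 * (L * s\<^sup>2 * (norm \<gamma>)\<^sup>2) / 2"
    by (simp add: power_mult_distrib power2_eq_square)
  finally have pot: "gap x1 \<le> gap y - s\<^sup>2 * inner (grad y) \<gamma> + s\<^sup>2 * (L * s\<^sup>2 * (norm \<gamma>)\<^sup>2) / 2" .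
  \<comment> \<open>The squared sample enters the potential with the factor \<open>L s\<^sup>2 / 2\<close> and the kinetic terms with at
    most \<open>K\<^sup>2 / 2\<close>, both times \<open>s\<^sup>2\<close>. Together they stay below \<open>s\<^sup>2\<close>, which the linear term
    \<open>- s\<^sup>2 \<langle>grad y, \<gamma>\<rangle>\<close> compensates in expectation, up to the variance.\<close>
  have Ls: "L * s\<^sup>2 + K\<^sup>2 \<le> 2"
  proof -
    have "L * s\<^sup>2 = (shift * q)\<^sup>2"
      by (simp add: s power_mult_distrib shift)
    also have "\<dots> \<le> (1 - q)\<^sup>2"
    proof (rule power_mono)
      have "shift * q \<le> N * q" using N q by (intro mult_right_mono) auto
      also have "\<dots> = 1 - q" using N1 by (simp add: q_def field_simps)
      finally show "shift * q \<le> 1 - q" .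
    qed (use q shift in auto)
    finally have "L * s\<^sup>2 + K\<^sup>2 \<le> (1 - q)\<^sup>2 + K\<^sup>2" by simp
    also have "\<dots> = 2 - q * (1 - 5 / 4 * q)"
      by (simp add: K_def power2_eq_square algebra_simps)
    also have "\<dots> \<le> 2" using q by simp
    finally show ?thesis .
  qed
  have "1 - q\<^sup>2 / 4 \<le> K\<^sup>2"
    using q by (simp add: K_def power2_eq_square algebra_simps)
  then have "(1 - q\<^sup>2 / 4) * (norm (P \<gamma>))\<^sup>2 \<le> K\<^sup>2 * (norm (P \<gamma>))\<^sup>2"
    by (intro mult_right_mono) auto
  then have "K\<^sup>2 * (norm (normal \<gamma>))\<^sup>2 + (1 - q\<^sup>2 / 4) * (norm (P \<gamma>))\<^sup>2 + L * s\<^sup>2 * (norm \<gamma>)\<^sup>2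
      \<le> (L * s\<^sup>2 + K\<^sup>2) * (norm \<gamma>)\<^sup>2"
    by (simp add: norm_P_normal[of \<gamma>] algebra_simps)
  also have "\<dots> \<le> 2 * (norm \<gamma>)\<^sup>2"
    using Ls by (intro mult_right_mono) auto
  finally have "s\<^sup>2 * (K\<^sup>2 * (norm (normal \<gamma>))\<^sup>2 + (1 - q\<^sup>2 / 4) * (norm (P \<gamma>))\<^sup>2 + L * s\<^sup>2 * (norm \<gamma>)\<^sup>2)
      \<le> s\<^sup>2 * (2 * (norm \<gamma>)\<^sup>2)"
    by (intro mult_left_mono) auto
  then have noise: "(K * s)\<^sup>2 * (norm (normal \<gamma>))\<^sup>2 / 2 + (1 - q\<^sup>2 / 4) * (s\<^sup>2 * (norm (P \<gamma>))\<^sup>2) / 2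
      + s\<^sup>2 * (L * s\<^sup>2 * (norm \<gamma>)\<^sup>2) / 2 \<le> s\<^sup>2 * (norm \<gamma>)\<^sup>2"
    by (simp add: power_mult_distrib algebra_simps diff_divide_distrib)
  have "energy (N + 1) (step N z \<gamma>) = gap x1
      + (norm (\<alpha> *\<^sub>R normal v1 + sqrt \<mu> *\<^sub>R offset (lookahead (N + 1) (x1, v1))))\<^sup>2 / 2
      + (1 - q\<^sup>2 / 4) * (((1 + q) / (1 - q))\<^sup>2 * (norm (P v1))\<^sup>2) / 2"
    by (simp add: energy_def step Let_def q_def[symmetric] \<alpha>_def[symmetric])
  also have "\<dots> = gap x1 + ((norm w)\<^sup>2 - 2 * (K * s) * inner w \<gamma> + (K * s)\<^sup>2 * (norm (normal \<gamma>))\<^sup>2) / 2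
      + (1 - q\<^sup>2 / 4) * ((norm (P v))\<^sup>2 - 2 * s * inner (P v) \<gamma> + s\<^sup>2 * (norm (P \<gamma>))\<^sup>2) / 2"
    by (simp only: nrm tng inner_w)
  also have "\<dots> \<le> gap y + (norm w)\<^sup>2 / 2 + (1 - q\<^sup>2 / 4) * (norm (P v))\<^sup>2 / 2
      - (s\<^sup>2 * inner (grad y) \<gamma> + K * s * inner w \<gamma> + s * (1 - q\<^sup>2 / 4) * inner (P v) \<gamma>)
      + s\<^sup>2 * (norm \<gamma>)\<^sup>2"
    using pot noise by (simp add: field_simps)
  finally show ?thesis
    by (simp add: inner_add_left K_def v_def)
qed

text \<open>
  The left-hand side is what the bound of \<open>energy_step\<close> becomes in expectation, without the variance.
  The weak convexity inequality is applied with the weight \<open>c = (1 - q) * (1 - q\<^sup>2 / 4)\<close> and the strong one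
  with \<open>q * (1 + q / 2)\<close>. These weights add up to \<open>1 + q\<^sup>2 / 4 + q ^ 3 / 4\<close>, and \<open>c\<close> is smaller than
  \<open>1 - q\<close>; both surpluses feed \<open>quadratic_form_nonneg\<close> through quadratic growth. The bound on \<open>\<epsilon>\<close> is
  exactly what makes the error of the weak convexity inequality harmless at \<open>N = shift + 1\<close>, where the step
  size \<open>\<eta>\<^sub>0\<close> multiplies the velocity.
\<close>

lemma energy_decay:
  fixes z :: "(real ^ 'd) \<times> (real ^ 'd)"
  assumes N: "N \<ge> shift + 1 \<or> N = shift \<and> snd z = 0"
  defines "q \<equiv> 1 / (N + 1)"
  defines "s \<equiv> q / sqrt \<mu>"
  defines "y \<equiv> lookahead N z"
  defines "w \<equiv> (1 - q / 2) *\<^sub>R normal (snd z) + sqrt \<mu> *\<^sub>R offset y"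
  shows "gap y + (norm w)\<^sup>2 / 2 + (1 - q\<^sup>2 / 4) * (norm (P (snd z)))\<^sup>2 / 2
    - s * (1 - q\<^sup>2 / 4) * inner (snd z) (grad y) - q * (1 + q / 2) * inner (offset y) (grad y)
    \<le> (1 - q) * energy N z"
proof -
  define v where "v = snd z"
  define u where "u = sqrt \<mu> *\<^sub>R offset y"
  define G1 where "G1 = inner v (grad y)"
  define G2 where "G2 = inner (offset y) (grad y)"
  define A where "A = (norm (normal v))\<^sup>2"
  define B where "B = inner (normal v) u"
  define C where "C = (norm u)\<^sup>2"
  define D where "D = (norm (P v))\<^sup>2"
  have N1: "N \<ge> 1" using N shift by auto
  have q: "0 < q" "q \<le> 1 / 2" using N1 by (auto simp: q_def field_simps)
  have C: "\<mu> * (norm (offset y))\<^sup>2 = C"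
    using mu_pos by (simp add: C_def u_def power_mult_distrib)
  have C0: "C \<ge> 0" by (simp add: C_def)
  have F: "gap y \<ge> C / 2" using quadratic_growth[of y] C by simp
  have G2: "G2 \<ge> gap y + C / 2"
    using strong_gap[of y] C by (simp add: G2_def inner_commute)
  have sq: "(norm (r *\<^sub>R normal v + u))\<^sup>2 = r\<^sup>2 * A + 2 * r * B + C" for r
    unfolding A_def B_def C_def power2_norm_eq_inner
    by (simp add: inner_add_left inner_add_right inner_commute power2_eq_square algebra_simps)
  have G2': "q * (1 + q / 2) * (gap y + C / 2) \<le> q * (1 + q / 2) * G2"
    using G2 q by (intro mult_left_mono) auto
  show ?thesis
  proof (cases "v = 0")
    case True
    then have z: "z = (y, 0)"
      by (simp add: y_def lookahead_def v_def prod_eq_iff)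
    have v0: "normal 0 = 0" "P 0 = 0" using linear_normal linear_P by (auto simp: linear_0)
    have "energy N z = gap y + C / 2"
      by (simp add: energy_def Let_def v0 z C_def u_def lookahead_def)
    moreover have "0 \<le> q\<^sup>2 / 2 * (gap y + C / 2)" using F C0 by simp
    moreover have "(norm w)\<^sup>2 = C" by (simp add: w_def z v0 C_def u_def)
    moreover have "P (snd z) = 0" "inner (snd z) (grad y) = 0" by (simp_all add: z v0)
    ultimately show ?thesis
      using G2' by (simp add: G2_def[symmetric] power2_eq_square algebra_simps diff_divide_distrib)
  next
    case False
    then have N2: "N \<ge> shift + 1" "N \<ge> 2" using N shift by (auto simp: v_def)
    define p where "p = 1 / N"
    define \<alpha> where "\<alpha> = (1 - p / 2 + p\<^sup>2 / 2) / (1 - p)"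
    define \<Lambda> where "\<Lambda> = (1 - p\<^sup>2 / 4) * ((1 + p) / (1 - p))\<^sup>2"
    have pq: "(1 - q) * p = q" using N1 by (simp add: p_def q_def field_simps)
    have p: "0 < p" "p \<le> 1 / 2" using N2 by (auto simp: p_def field_simps)
    have y: "y = fst z + (p / sqrt \<mu>) *\<^sub>R v" by (simp add: y_def lookahead_def p_def v_def)
    have energy: "energy N z = gap (fst z) + (\<alpha>\<^sup>2 * A + 2 * \<alpha> * B + C) / 2 + \<Lambda> * D / 2"
      by (simp only: energy_def Let_def p_def[symmetric] y_def[symmetric] \<alpha>_def[symmetric]
          \<Lambda>_def u_def[symmetric] v_def[symmetric] sq D_def)
    have Fx: "gap (fst z) \<ge> (C - 2 * p * B + p\<^sup>2 * A) / 2"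
    proof -
      have "offset (fst z) = offset (y + (- (p / sqrt \<mu>)) *\<^sub>R v)" by (simp add: y)
      also have "\<dots> = offset y - (p / sqrt \<mu>) *\<^sub>R normal v"
        unfolding offset_add using linear_normal by (simp add: linear_scale linear_neg)
      finally have "sqrt \<mu> *\<^sub>R offset (fst z) = (- p) *\<^sub>R normal v + u"
        using mu_pos by (simp add: u_def scaleR_diff_right)
      then have "\<mu> * (norm (offset (fst z)))\<^sup>2 = (norm ((- p) *\<^sub>R normal v + u))\<^sup>2"
        using mu_pos by (metis abs_of_pos norm_scaleR power_mult_distrib real_sqrt_gt_zero real_sqrt_pow2 less_imp_le)
      then show ?thesis
        using quadratic_growth[of "fst z"] by (simp only: sq) simp
    qed
    have W: "p / sqrt \<mu> * G1 \<ge> gap y - gap (fst z) - \<epsilon> / 2 * (p\<^sup>2 / \<mu>) * (A + D)"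
    proof -
      have "(norm ((p / sqrt \<mu>) *\<^sub>R v))\<^sup>2 = p\<^sup>2 / \<mu> * (A + D)"
        using mu_pos by (simp add: power_mult_distrib power_divide A_def D_def norm_P_normal[of v])
      then show ?thesis
        using weak_gap[of "fst z" "(p / sqrt \<mu>) *\<^sub>R v"]
        by (simp add: y[symmetric] G1_def inner_commute)
    qed
    have eps_p: "\<epsilon> * (p\<^sup>2 / \<mu>) \<le> p"
    proof -
      have "sqrt (\<mu> / step_size L \<mu> 0) = \<mu> * (shift + 1)"
        using mu_pos shift(1)
        by (simp add: step_size_def shift_def[symmetric] real_sqrt_mult abs_of_nonneg)
      then have "\<epsilon> \<le> \<mu> * (shift + 1)" using eps by simp
      also have "\<dots> \<le> \<mu> * N" using N2 mu_pos by simp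
      finally have "\<epsilon> * (p\<^sup>2 / \<mu>) \<le> \<mu> * N * (p\<^sup>2 / \<mu>)"
        using mu_pos by (intro mult_right_mono) auto
      also have "\<dots> = p" using mu_pos N2 by (simp add: p_def power2_eq_square)
      finally show ?thesis .
    qed
    define c where "c = (1 - q) * (1 - q\<^sup>2 / 4)"
    have q24: "q\<^sup>2 / 4 < 1" using q power_mono[of q "1/2" 2] by (simp add: power2_eq_square)
    have c0: "0 \<le> c" using q q24 by (simp add: c_def)
    have AD: "0 \<le> A" "0 \<le> D" by (auto simp: A_def D_def)
    have S: "s * (1 - q\<^sup>2 / 4) * G1 = c * (p / sqrt \<mu> * G1)"
    proof -
      have "s = (1 - q) * (p / sqrt \<mu>)" using pq by (metis s_def times_divide_eq_right)
      then show ?thesis by (simp add: c_def)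
    qed
    have "c * (gap y - gap (fst z) - \<epsilon> / 2 * (p\<^sup>2 / \<mu>) * (A + D)) \<le> c * (p / sqrt \<mu> * G1)"
      using W c0 by (rule mult_left_mono)
    moreover have "c * (\<epsilon> * (p\<^sup>2 / \<mu>)) * (A + D) \<le> q * (1 - q\<^sup>2 / 4) * (A + D)"
    proof (rule mult_right_mono)
      have "c * (\<epsilon> * (p\<^sup>2 / \<mu>)) \<le> c * p" using eps_p c0 by (rule mult_left_mono)
      also have "c * p = ((1 - q) * p) * (1 - q\<^sup>2 / 4)" by (simp add: c_def mult_ac)
      also have "\<dots> = q * (1 - q\<^sup>2 / 4)" unfolding pq ..
      finally show "c * (\<epsilon> * (p\<^sup>2 / \<mu>)) \<le> q * (1 - q\<^sup>2 / 4)" .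
    qed (use AD in auto)
    ultimately have S': "s * (1 - q\<^sup>2 / 4) * G1 \<ge> c * gap y - c * gap (fst z) - q * (1 - q\<^sup>2 / 4) * (A + D) / 2"
      unfolding S by (simp add: algebra_simps diff_divide_distrib add_divide_distrib)
    have Fy': "(q\<^sup>2 / 4 + q^3 / 4) * C / 2 \<le> (q\<^sup>2 / 4 + q^3 / 4) * gap y"
      using mult_left_mono[OF F, of "q\<^sup>2 / 4 + q^3 / 4"] q by simp
    have Fx': "(1 - q) * (q\<^sup>2 / 4) * (C - 2 * p * B + p\<^sup>2 * A) / 2 \<le> (1 - q) * (q\<^sup>2 / 4) * gap (fst z)"
      using mult_left_mono[OF Fx, of "(1 - q) * (q\<^sup>2 / 4)"] q by simp
    have AC: "0 \<le> C + 2 * r * B + r\<^sup>2 * A" for r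
      using sq[of r] by (metis add.commute add.assoc zero_le_power2 add.left_commute)
    have Qf: "(1 - q / 2)\<^sup>2 * A + 2 * (1 - q / 2) * B + C + q * (1 - q\<^sup>2 / 4) * A
      \<le> (1 - q) * (\<alpha>\<^sup>2 * A + 2 * \<alpha> * B + C)
      + q * (1 + q / 2) * C + (q\<^sup>2 / 4 + q^3 / 4) * C + (1 - q) * (q\<^sup>2 / 4) * (C - 2 * p * B + p\<^sup>2 * A)"
      using quadratic_form_nonneg[OF N2(2) AC AD(1)]
      by (simp only: \<alpha>_def p_def[symmetric] q_def[symmetric])
    have Df: "(1 - q\<^sup>2 / 4) * (1 + q) * D \<le> (1 - q) * \<Lambda> * D"
    proof (rule mult_right_mono)
      have "(1 - q\<^sup>2 / 4) * (1 + q) \<le> 1 + q" using q by (simp add: algebra_simps)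
      also have "\<dots> = (N + 2) / (N + 1)" using N1 by (simp add: q_def field_simps)
      also have "\<dots> \<le> (N + 1) * (4 * N\<^sup>2 - 1) / (4 * N * (N - 1)\<^sup>2)"
      proof -
        have "(N + 2) * (4 * N * (N - 1)\<^sup>2) \<le> (N + 1) * (4 * N\<^sup>2 - 1) * (N + 1)"
        proof -
          have "(N + 1) * (4 * N\<^sup>2 - 1) * (N + 1) - (N + 2) * (4 * N * (N - 1)\<^sup>2)
              = 8 * N^3 + 15 * N\<^sup>2 - 10 * N - 1"
            by (simp add: power2_eq_square power3_eq_cube algebra_simps)
          moreover have "8 * N^3 + 15 * N\<^sup>2 - 10 * N - 1 = (N - 1) * (8 * N\<^sup>2 + 23 * N + 13) + 12"
            by (simp add: power2_eq_square power3_eq_cube algebra_simps)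
          moreover have "0 \<le> (N - 1) * (8 * N\<^sup>2 + 23 * N + 13)" using N2 by simp
          ultimately show ?thesis by linarith
        qed
        then show ?thesis using N2 by (simp add: divide_le_eq le_divide_eq mult_ac field_simps)
      qed
      also have "\<dots> = (1 - q) * \<Lambda>"
        using N2 by (simp add: \<Lambda>_def p_def q_def power_divide divide_simps) algebra
      finally show "(1 - q\<^sup>2 / 4) * (1 + q) \<le> (1 - q) * \<Lambda>" .
    qed (use AD in auto)
    have cd: "1 - c - q * (1 + q / 2) = - (q\<^sup>2 / 4 + q^3 / 4)" "c = (1 - q) - (1 - q) * (q\<^sup>2 / 4)"
      by (simp_all add: c_def power2_eq_square power3_eq_cube field_simps)
    have nw: "(norm w)\<^sup>2 = (1 - q / 2)\<^sup>2 * A + 2 * (1 - q / 2) * B + C"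
      using sq by (simp add: w_def u_def v_def)
    have "gap y + (norm w)\<^sup>2 / 2 + (1 - q\<^sup>2 / 4) * D / 2
        - s * (1 - q\<^sup>2 / 4) * G1 - q * (1 + q / 2) * G2
      \<le> (1 - c - q * (1 + q / 2)) * gap y + c * gap (fst z)
        + ((1 - q / 2)\<^sup>2 * A + 2 * (1 - q / 2) * B + C + q * (1 - q\<^sup>2 / 4) * A) / 2
        - q * (1 + q / 2) * C / 2 + (1 - q\<^sup>2 / 4) * (1 + q) * D / 2"
    proof -
      define T d E where "T = 1 - q\<^sup>2 / 4" and "d = q * (1 + q / 2)"
        and "E = (1 - q / 2)\<^sup>2 * A + 2 * (1 - q / 2) * B + C"
      have "q * T * (A + D) = q * T * A + q * T * D"
        "(1 - c - d) * gap y = gap y - c * gap y - d * gap y"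
        "d * (gap y + C / 2) = d * gap y + d * C / 2"
        "T * (1 + q) * D = T * D + q * T * D"
        by (simp_all add: algebra_simps)
      then show ?thesis
        using S' G2' unfolding nw T_def[symmetric] d_def[symmetric] E_def[symmetric] by argo
    qed
    also have "\<dots> \<le> (1 - q) * gap (fst z) + (1 - q) * (\<alpha>\<^sup>2 * A + 2 * \<alpha> * B + C) / 2 + (1 - q) * \<Lambda> * D / 2"
    proof -
      have "c * gap (fst z) = (1 - q) * gap (fst z) - (1 - q) * (q\<^sup>2 / 4) * gap (fst z)"
        by (subst cd(2)) (simp add: left_diff_distrib)
      \<comment> \<open>Naming the products makes the claim linear.\<close>
      moreover define H1 H2 H3 H4 where "H1 = (1 - q) * (q\<^sup>2 / 4) * (C - 2 * p * B + p\<^sup>2 * A)"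
        and "H2 = (q\<^sup>2 / 4 + q^3 / 4) * C" and "H3 = (q\<^sup>2 / 4 + q^3 / 4) * gap y"
        and "H4 = (1 - q) * (\<alpha>\<^sup>2 * A + 2 * \<alpha> * B + C)"
      moreover define H5 H6 H7 H8 where "H5 = (1 - q) * \<Lambda> * D" and "H6 = (1 - q\<^sup>2 / 4) * (1 + q) * D"
        and "H7 = (1 - q / 2)\<^sup>2 * A + 2 * (1 - q / 2) * B + C + q * (1 - q\<^sup>2 / 4) * A"
        and "H8 = q * (1 + q / 2) * C"
      ultimately show ?thesis
        using Fx' Fy' Qf Df
        unfolding cd(1) mult_minus_left H1_def[symmetric] H2_def[symmetric] H3_def[symmetric]
          H4_def[symmetric] H5_def[symmetric] H6_def[symmetric] H7_def[symmetric] H8_def[symmetric]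
        by argo
    qed
    also have "\<dots> = (1 - q) * energy N z"
      unfolding energy by (simp only: distrib_left times_divide_eq_right mult.assoc)
    finally show ?thesis
      by (simp add: D_def v_def G1_def G2_def)
  qed
qed

lemma energy_nonneg: "N \<ge> 1 \<Longrightarrow> energy N z \<ge> 0"
proof -
  assume N: "N \<ge> 1"
  then have "(1 / N)\<^sup>2 \<le> 1" by (simp add: power_le_one)
  then show ?thesis
    unfolding energy_def Let_def by (intro add_nonneg_nonneg gap_nonneg divide_nonneg_nonneg mult_nonneg_nonneg) auto
qed

text \<open>
  Averaging the pointwise bound: unbiasedness replaces \<open>\<gamma>\<close> by the gradient in the linear term, and the
  second moment is the squared norm of the gradient plus the variance.
\<close>

lemma expected_energy_step:
  fixes Q :: "'w measure" and \<gamma> :: "'w \<Rightarrow> real ^ 'd"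
  assumes N: "N \<ge> shift + 1 \<or> N = shift \<and> snd z = 0"
    and Q: "prob_space Q" and meas: "\<gamma> \<in> borel_measurable Q"
    and mean: "(\<integral>w. \<gamma> w \<partial>Q) = grad (lookahead N z)"
    and sq: "integrable Q (\<lambda>w. (norm (\<gamma> w))\<^sup>2)"
    and var: "(\<integral>w. (norm (\<gamma> w - grad (lookahead N z)))\<^sup>2 \<partial>Q) \<le> \<sigma>\<^sup>2"
  defines "q \<equiv> 1 / (N + 1)"
  shows "(\<integral>\<^sup>+ w. ennreal (energy (N + 1) (step N z (\<gamma> w))) \<partial>Q)
    \<le> ennreal (1 - q) * ennreal (energy N z) + ennreal (\<sigma>\<^sup>2 * (q\<^sup>2 / \<mu>))"
proof -
  interpret Q: prob_space Q by (rule Q)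
  define y where "y = lookahead N z"
  define s where "s = q / sqrt \<mu>"
  define w where "w = (1 - q / 2) *\<^sub>R normal (snd z) + sqrt \<mu> *\<^sub>R offset y"
  define m where "m = s\<^sup>2 *\<^sub>R grad y + ((1 + q / 2) * s) *\<^sub>R w + (s * (1 - q\<^sup>2 / 4)) *\<^sub>R P (snd z)"
  define A where "A = gap y + (norm w)\<^sup>2 / 2 + (1 - q\<^sup>2 / 4) * (norm (P (snd z)))\<^sup>2 / 2"
  define h where "h \<omega> = A - inner m (\<gamma> \<omega>) + s\<^sup>2 * (norm (\<gamma> \<omega>))\<^sup>2" for \<omega>
  have N1: "N \<ge> 1" "N \<ge> shift" using N shift by auto
  have q: "0 < q" "q \<le> 1" using N1 by (auto simp: q_def field_simps)
  have s2: "s\<^sup>2 = q\<^sup>2 / \<mu>" "sqrt \<mu> * s = q" using mu_pos by (auto simp: s_def power_divide)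
  have int: "integrable Q \<gamma>"
    using Q.square_integrable_imp_integrable[of "\<lambda>\<omega>. norm (\<gamma> \<omega>)"] sq meas
    by (simp add: integrable_norm_iff)
  have bound: "energy (N + 1) (step N z (\<gamma> \<omega>)) \<le> h \<omega>" for \<omega>
    using energy_step[OF N1(2), of z "\<gamma> \<omega>"]
    by (simp only: h_def A_def m_def w_def y_def s_def q_def)
  have h_nonneg: "0 \<le> h \<omega>" for \<omega>
    using bound[of \<omega>] energy_nonneg[of "N + 1" "step N z (\<gamma> \<omega>)"] N1 by linarith
  have h_int: "integrable Q h"
    unfolding h_def using int sq by simp
  have var_eq: "(\<integral>\<omega>. (norm (\<gamma> \<omega> - grad y))\<^sup>2 \<partial>Q) = (\<integral>\<omega>. (norm (\<gamma> \<omega>))\<^sup>2 \<partial>Q) - (norm (grad y))\<^sup>2"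
  proof -
    have "(\<integral>\<omega>. (norm (\<gamma> \<omega> - grad y))\<^sup>2 \<partial>Q)
      = (\<integral>\<omega>. (norm (\<gamma> \<omega>))\<^sup>2 - 2 * inner (grad y) (\<gamma> \<omega>) + (norm (grad y))\<^sup>2 \<partial>Q)"
      by (rule Bochner_Integration.integral_cong)
        (auto simp: power2_norm_eq_inner inner_diff_left inner_diff_right inner_commute)
    also have "\<dots> = (\<integral>\<omega>. (norm (\<gamma> \<omega>))\<^sup>2 \<partial>Q) - 2 * inner (grad y) (grad y) + (norm (grad y))\<^sup>2"
      using int sq mean by (simp add: y_def Q.prob_space)
    finally show ?thesis by (simp add: power2_norm_eq_inner)
  qed
  have "(\<integral>\<omega>. h \<omega> \<partial>Q) = A - inner m (grad y) + s\<^sup>2 * (\<integral>\<omega>. (norm (\<gamma> \<omega>))\<^sup>2 \<partial>Q)"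
    unfolding h_def using int sq mean by (simp add: y_def Q.prob_space)
  also have "\<dots> \<le> A - inner m (grad y) + s\<^sup>2 * ((norm (grad y))\<^sup>2 + \<sigma>\<^sup>2)"
    using var var_eq by (intro add_left_mono mult_left_mono) (auto simp: y_def)
  also have "\<dots> = A - (1 + q / 2) * s * inner w (grad y)
      - s * (1 - q\<^sup>2 / 4) * inner (P (snd z)) (grad y) + s\<^sup>2 * \<sigma>\<^sup>2"
    by (simp add: m_def inner_add_left power2_norm_eq_inner algebra_simps)
  also have "\<dots> = A - s * (1 - q\<^sup>2 / 4) * inner (snd z) (grad y)
      - q * (1 + q / 2) * inner (offset y) (grad y) + \<sigma>\<^sup>2 * (q\<^sup>2 / \<mu>)"
  proof -
    have "inner (snd z) (grad y) = inner (P (snd z)) (grad y) + inner (normal (snd z)) (grad y)"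
      by (simp add: normal_def inner_diff_left)
    moreover have "(1 + q / 2) * s * inner w (grad y)
        = s * (1 - q\<^sup>2 / 4) * inner (normal (snd z)) (grad y) + (sqrt \<mu> * s) * (1 + q / 2) * inner (offset y) (grad y)"
      by (simp add: w_def inner_add_left power2_eq_square algebra_simps)
    ultimately show ?thesis unfolding s2 by (simp add: algebra_simps)
  qed
  also have "\<dots> \<le> (1 - q) * energy N z + \<sigma>\<^sup>2 * (q\<^sup>2 / \<mu>)"
    using energy_decay[OF N] by (simp add: A_def w_def y_def s_def q_def)
  finally have h_le: "(\<integral>\<omega>. h \<omega> \<partial>Q) \<le> (1 - q) * energy N z + \<sigma>\<^sup>2 * (q\<^sup>2 / \<mu>)" .
  have "(\<integral>\<^sup>+ \<omega>. ennreal (energy (N + 1) (step N z (\<gamma> \<omega>))) \<partial>Q) \<le> (\<integral>\<^sup>+ \<omega>. ennreal (h \<omega>) \<partial>Q)"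
    by (intro nn_integral_mono ennreal_leI bound)
  also have "\<dots> = ennreal (\<integral>\<omega>. h \<omega> \<partial>Q)"
    using h_int h_nonneg by (intro nn_integral_eq_integral) auto
  also have "\<dots> \<le> ennreal ((1 - q) * energy N z + \<sigma>\<^sup>2 * (q\<^sup>2 / \<mu>))"
    using h_le by (rule ennreal_leI)
  also have "\<dots> = ennreal (1 - q) * ennreal (energy N z) + ennreal (\<sigma>\<^sup>2 * (q\<^sup>2 / \<mu>))"
    using q energy_nonneg[OF N1(1), of z] mu_pos by (simp add: ennreal_plus ennreal_mult)
  finally show ?thesis .
qed

lemma measurable_gap [measurable]: "gap \<in> borel_measurable borel"
proof -
  have "continuous_on UNIV f"
    using grad by (intro has_derivative_continuous_on) (auto simp: gderiv_def)
  then show ?thesis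
    unfolding gap_def[abs_def] by (intro borel_measurable_diff borel_measurable_continuous_onI) auto
qed

lemma measurable_P [measurable]: "P \<in> borel_measurable borel"
  by (intro borel_measurable_continuous_onI linear_continuous_on linear_P linear_conv_bounded_linear[THEN iffD1])

lemma measurable_normal [measurable]: "normal \<in> borel_measurable borel"
  unfolding normal_def[abs_def] by measurable

lemma measurable_offset [measurable]: "offset \<in> borel_measurable borel"
  unfolding offset_def[abs_def] by measurable

lemma measurable_fst_snd_borel [measurable]:
  "(fst :: (real ^ 'd) \<times> (real ^ 'd) \<Rightarrow> _) \<in> borel_measurable borel"
  "(snd :: (real ^ 'd) \<times> (real ^ 'd) \<Rightarrow> _) \<in> borel_measurable borel"
  by (intro borel_measurable_continuous_onI continuous_intros)+

lemma measurable_lookahead [measurable]: "lookahead N \<in> borel_measurable borel"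
  unfolding lookahead_def[abs_def] by measurable

lemma measurable_energy [measurable]: "energy N \<in> borel_measurable borel"
  unfolding energy_def[abs_def] Let_def by measurable

lemma measurable_step:
  assumes [measurable]: "Z \<in> borel_measurable A" "G \<in> borel_measurable A"
  shows "(\<lambda>a. step N (Z a) (G a)) \<in> borel_measurable A"
  unfolding step_def Let_def by (intro borel_measurable_Pair) measurable

end

section \<open>Fresh noise\<close>

text \<open>
  Independence of two random variables whose value spaces may have different types, in contrast to
  \<^const>\<open>prob_space.indep_var\<close>: the initial condition is a vector, the noise a sequence.
\<close>

definition (in prob_space) indep_pair ::
    "'b measure \<Rightarrow> ('a \<Rightarrow> 'b) \<Rightarrow> 'c measure \<Rightarrow> ('a \<Rightarrow> 'c) \<Rightarrow> bool" where
  "indep_pair S X T Y \<longleftrightarrow> X \<in> measurable M S \<and> Y \<in> measurable M T \<and>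
     (\<forall>A\<in>sets S. \<forall>B\<in>sets T. prob ((X -` A \<inter> space M) \<inter> (Y -` B \<inter> space M))
        = prob (X -` A \<inter> space M) * prob (Y -` B \<inter> space M))"

lemma (in prob_space) indep_pair_of_indep_set:
  assumes X: "X \<in> measurable M S" and Y: "Y \<in> measurable M T"
    and indep: "indep_set (sets (vimage_algebra (space M) X S)) (sets (vimage_algebra (space M) Y T))"
  shows "indep_pair S X T Y"
  unfolding indep_pair_def using X Y
  by (auto intro!: indep_setD[OF indep] in_vimage_algebra)

lemma (in prob_space) indep_pair_compose:
  assumes XY: "indep_pair S X T Y" and g: "g \<in> measurable S S'" and h: "h \<in> measurable T T'"
  shows "indep_pair S' (\<lambda>s. g (X s)) T' (\<lambda>s. h (Y s))"
proof -
  have X: "X \<in> measurable M S" and Y: "Y \<in> measurable M T"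
    using XY by (auto simp: indep_pair_def)
  have gX: "(\<lambda>s. g (X s)) -` A \<inter> space M = X -` (g -` A \<inter> space S) \<inter> space M" for A
    using measurable_space[OF X] by auto
  have hY: "(\<lambda>s. h (Y s)) -` B \<inter> space M = Y -` (h -` B \<inter> space T) \<inter> space M" for B
    using measurable_space[OF Y] by auto
  show ?thesis
    unfolding indep_pair_def gX hY
    using XY measurable_sets[OF g] measurable_sets[OF h] measurable_compose[OF X g] measurable_compose[OF Y h]
    unfolding indep_pair_def by blast
qed

lemma (in prob_space) indep_pair_distr:
  assumes XY: "indep_pair S X T Y"
  shows "distr M S X \<Otimes>\<^sub>M distr M T Y = distr M (S \<Otimes>\<^sub>M T) (\<lambda>s. (X s, Y s))"
proof -
  have X [measurable]: "X \<in> measurable M S" and Y [measurable]: "Y \<in> measurable M T"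
    using XY by (auto simp: indep_pair_def)
  interpret S: prob_space "distr M S X" by (rule prob_space_distr) measurable
  interpret T: prob_space "distr M T Y" by (rule prob_space_distr) measurable
  show ?thesis
  proof (rule pair_measure_eqI)
    fix A B assume A: "A \<in> sets (distr M S X)" and B: "B \<in> sets (distr M T Y)"
    then have [measurable]: "A \<in> sets S" "B \<in> sets T" by auto
    have eq: "(\<lambda>s. (X s, Y s)) -` (A \<times> B) \<inter> space M = (X -` A \<inter> space M) \<inter> (Y -` B \<inter> space M)" by auto
    have "emeasure (distr M (S \<Otimes>\<^sub>M T) (\<lambda>s. (X s, Y s))) (A \<times> B)
        = ennreal (prob ((X -` A \<inter> space M) \<inter> (Y -` B \<inter> space M)))"
      by (subst emeasure_distr) (auto simp: eq emeasure_eq_measure)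
    also have "\<dots> = ennreal (prob (X -` A \<inter> space M)) * ennreal (prob (Y -` B \<inter> space M))"
      using XY by (simp add: indep_pair_def ennreal_mult)
    also have "\<dots> = emeasure (distr M S X) A * emeasure (distr M T Y) B"
      by (simp add: emeasure_distr emeasure_eq_measure)
    finally show "emeasure (distr M S X) A * emeasure (distr M T Y) B
        = emeasure (distr M (S \<Otimes>\<^sub>M T) (\<lambda>s. (X s, Y s))) (A \<times> B)" ..
  qed (auto simp: S.sigma_finite_measure_axioms T.sigma_finite_measure_axioms)
qed

lemma (in prob_space) nn_integral_indep_pair:
  assumes XY: "indep_pair S X T Y" and F [measurable]: "F \<in> borel_measurable (S \<Otimes>\<^sub>M T)"
  shows "(\<integral>\<^sup>+ s. F (X s, Y s) \<partial>M) = (\<integral>\<^sup>+ s. \<integral>\<^sup>+ t. F (X s, Y t) \<partial>M \<partial>M)"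
proof -
  have [measurable]: "X \<in> measurable M S" "Y \<in> measurable M T"
    using XY by (auto simp: indep_pair_def)
  interpret T: prob_space "distr M T Y" by (rule prob_space_distr) measurable
  have "(\<integral>\<^sup>+ s. F (X s, Y s) \<partial>M) = (\<integral>\<^sup>+ u. F u \<partial>distr M (S \<Otimes>\<^sub>M T) (\<lambda>s. (X s, Y s)))"
    by (subst nn_integral_distr) auto
  also have "\<dots> = (\<integral>\<^sup>+ u. F u \<partial>(distr M S X \<Otimes>\<^sub>M distr M T Y))"
    by (simp only: indep_pair_distr[OF XY])
  also have "\<dots> = (\<integral>\<^sup>+ a. \<integral>\<^sup>+ b. F (a, b) \<partial>distr M T Y \<partial>distr M S X)"
    by (subst T.nn_integral_fst[symmetric]) auto
  also have "\<dots> = (\<integral>\<^sup>+ s. \<integral>\<^sup>+ b. F (X s, b) \<partial>distr M T Y \<partial>M)"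
    by (subst nn_integral_distr) auto
  also have "\<dots> = (\<integral>\<^sup>+ s. \<integral>\<^sup>+ t. F (X s, Y t) \<partial>M \<partial>M)"
  proof (rule nn_integral_cong)
    fix s assume "s \<in> space M"
    then have [measurable]: "X s \<in> space S" by (rule measurable_space[rotated]) measurable
    show "(\<integral>\<^sup>+ b. F (X s, b) \<partial>distr M T Y) = (\<integral>\<^sup>+ t. F (X s, Y t) \<partial>M)"
      by (subst nn_integral_distr) auto
  qed
  finally show ?thesis .
qed

text \<open>
  If \<open>X\<close> is independent of \<open>(Y, W)\<close> and \<open>Y\<close> of \<open>W\<close>, then \<open>W\<close> is independent of the pair \<open>(X, Y)\<close> and may
  be integrated out first. Both sides reduce to the same threefold integral: the left one by separating
  \<open>X\<close> from \<open>(Y, W)\<close> and then \<open>Y\<close> from \<open>W\<close>, the right one by separating \<open>X\<close> from \<open>Y\<close>.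
\<close>

lemma (in prob_space) nn_integral_fresh:
  assumes X_YW: "indep_pair S X (T \<Otimes>\<^sub>M U) (\<lambda>s. (Y s, W s))" and YW: "indep_pair T Y U W"
    and F [measurable]: "F \<in> borel_measurable ((S \<Otimes>\<^sub>M T) \<Otimes>\<^sub>M U)"
  shows "(\<integral>\<^sup>+ s. F ((X s, Y s), W s) \<partial>M) = (\<integral>\<^sup>+ s. \<integral>\<^sup>+ w. F ((X s, Y s), w) \<partial>distr M U W \<partial>M)"
proof -
  have [measurable]: "X \<in> measurable M S" "Y \<in> measurable M T" "W \<in> measurable M U"
    using X_YW YW by (auto simp: indep_pair_def)
  interpret U: prob_space "distr M U W" by (rule prob_space_distr) measurable
  have XY: "indep_pair S X T Y"
    using indep_pair_compose[OF X_YW measurable_ident measurable_fst] by simp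
  define H where "H a = (\<integral>\<^sup>+ w. F (a, w) \<partial>distr M U W)" for a
  have H [measurable]: "H \<in> borel_measurable (S \<Otimes>\<^sub>M T)"
    unfolding H_def by measurable
  have "(\<integral>\<^sup>+ s. F ((X s, Y s), W s) \<partial>M)
      = (\<integral>\<^sup>+ s. (\<lambda>(a, b, c). F ((a, b), c)) (X s, (Y s, W s)) \<partial>M)" by simp
  also have "\<dots> = (\<integral>\<^sup>+ s. \<integral>\<^sup>+ t. F ((X s, Y t), W t) \<partial>M \<partial>M)"
    by (subst nn_integral_indep_pair[OF X_YW]) auto
  also have "\<dots> = (\<integral>\<^sup>+ s. \<integral>\<^sup>+ t. H (X s, Y t) \<partial>M \<partial>M)"
  proof (rule nn_integral_cong)
    fix s assume "s \<in> space M"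
    then have [measurable]: "X s \<in> space S" by (rule measurable_space[rotated]) measurable
    have "(\<integral>\<^sup>+ t. F ((X s, Y t), W t) \<partial>M) = (\<integral>\<^sup>+ t. (\<lambda>(b, c). F ((X s, b), c)) (Y t, W t) \<partial>M)" by simp
    also have "\<dots> = (\<integral>\<^sup>+ t. \<integral>\<^sup>+ t'. F ((X s, Y t), W t') \<partial>M \<partial>M)"
      by (subst nn_integral_indep_pair[OF YW]) auto
    also have "\<dots> = (\<integral>\<^sup>+ t. H (X s, Y t) \<partial>M)"
    proof (rule nn_integral_cong)
      fix t assume "t \<in> space M"
      then have [measurable]: "Y t \<in> space T" by (rule measurable_space[rotated]) measurable
      show "(\<integral>\<^sup>+ t'. F ((X s, Y t), W t') \<partial>M) = H (X s, Y t)"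
        unfolding H_def by (subst nn_integral_distr) auto
    qed
    finally show "(\<integral>\<^sup>+ t. F ((X s, Y t), W t) \<partial>M) = (\<integral>\<^sup>+ t. H (X s, Y t) \<partial>M)" .
  qed
  also have "\<dots> = (\<integral>\<^sup>+ s. H (X s, Y s) \<partial>M)"
    by (rule nn_integral_indep_pair[OF XY H, symmetric])
  finally show ?thesis by (simp add: H_def)
qed

lemma (in prob_space) indep_pair_past_present:
  fixes \<omega> :: "nat \<Rightarrow> 'a \<Rightarrow> 'w"
  assumes indep: "indep_vars (\<lambda>_. Q) \<omega> UNIV"
  shows "indep_pair (PiM {..<n} (\<lambda>_. Q)) (\<lambda>s. restrict (\<lambda>k. \<omega> k s) {..<n}) Q (\<omega> n)"
proof -
  have var: "indep_var (PiM {..<n} (\<lambda>_. Q)) (\<lambda>s. restrict (\<lambda>k. \<omega> k s) {..<n})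
      (PiM {n} (\<lambda>_. Q)) (\<lambda>s. restrict (\<lambda>k. \<omega> k s) {n})"
    by (rule indep_var_restrict[OF indep]) auto
  have "indep_pair (PiM {..<n} (\<lambda>_. Q)) (\<lambda>s. restrict (\<lambda>k. \<omega> k s) {..<n})
      (PiM {n} (\<lambda>_. Q)) (\<lambda>s. restrict (\<lambda>k. \<omega> k s) {n})"
    using var unfolding indep_var_eq
    by (intro indep_pair_of_indep_set) (auto simp: sets_vimage_algebra)
  from indep_pair_compose[OF this measurable_ident measurable_component_singleton[of n]]
  show ?thesis by simp
qed

section \<open>The expected energy along the scheme\<close>

locale stochastic_scheme = affine_minimizers f grad V P xstar L \<mu> \<epsilon>
  for f :: "real ^ 'd \<Rightarrow> real" and grad V P xstar L \<mu> \<epsilon> +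
  fixes Q :: "'w measure" and g :: "real ^ 'd \<Rightarrow> 'w \<Rightarrow> real ^ 'd" and \<sigma> :: real
    and M :: "'s measure" and \<omega> :: "nat \<Rightarrow> 's \<Rightarrow> 'w"
    and x0 :: "'s \<Rightarrow> real ^ 'd" and Z :: "nat \<Rightarrow> 's \<Rightarrow> (real ^ 'd) \<times> (real ^ 'd)"
  assumes Q: "prob_space Q"
    and g_meas: "(\<lambda>(y, w). g y w) \<in> borel_measurable (borel \<Otimes>\<^sub>M Q)"
    and g_unbiased: "\<And>y. (\<integral>w. g y w \<partial>Q) = grad y"
    and g_square_int: "\<And>y. integrable Q (\<lambda>w. (norm (g y w))\<^sup>2)"
    and g_variance: "\<And>y. (\<integral>w. (norm (g y w - grad y))\<^sup>2 \<partial>Q) \<le> \<sigma>\<^sup>2"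
    and M: "prob_space M"
    and x0_meas [measurable]: "x0 \<in> borel_measurable M"
    and omega_indep: "prob_space.indep_vars M (\<lambda>_. Q) \<omega> UNIV"
    and omega_law: "\<And>n. distr M Q (\<omega> n) = Q"
    and x0_indep: "prob_space.indep_set M
          (sets (vimage_algebra (space M) x0 borel))
          (sets (vimage_algebra (space M) (\<lambda>s n. \<omega> n s) (\<Pi>\<^sub>M n\<in>UNIV. Q)))"
    and Z_0: "\<And>s. s \<in> space M \<Longrightarrow> Z 0 s = (x0 s, 0)"
    and Z_Suc: "\<And>n s. s \<in> space M \<Longrightarrow> Z (Suc n) s
        = step (real n + shift) (Z n s) (g (lookahead (real n + shift) (Z n s)) (\<omega> n s))"
begin

sublocale M: prob_space M by (rule M)

lemma measurable_omega [measurable]: "\<omega> n \<in> measurable M Q"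
  using omega_indep by (simp add: M.indep_vars_def2)

lemma measurable_oracle [measurable]:
  assumes [measurable]: "Y \<in> borel_measurable A" "W \<in> measurable A Q"
  shows "(\<lambda>a. g (Y a) (W a)) \<in> borel_measurable A"
  using measurable_compose[of "\<lambda>a. (Y a, W a)" A "borel \<Otimes>\<^sub>M Q", OF _ g_meas] by simp

abbreviation past :: "nat \<Rightarrow> 's \<Rightarrow> nat \<Rightarrow> 'w" where
  "past n s \<equiv> restrict (\<lambda>k. \<omega> k s) {..<n}"

text \<open>
  A state depends on the noise only through the samples already drawn, in a measurable way.
\<close>

lemma state_adapted:
  "\<exists>H \<in> borel_measurable (borel \<Otimes>\<^sub>M PiM {..<n} (\<lambda>_. Q)). \<forall>s\<in>space M. Z n s = H (x0 s, past n s)"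
proof (induction n)
  case 0
  have "(\<lambda>a. (fst a, 0 :: real ^ 'd)) \<in> borel_measurable ((borel :: (real ^ 'd) measure) \<Otimes>\<^sub>M PiM {..<0} (\<lambda>_. Q))"
    by (intro borel_measurable_Pair) auto
  then show ?case by (rule bexI[rotated]) (simp add: Z_0)
next
  case (Suc n)
  then obtain H where H [measurable]: "H \<in> borel_measurable (borel \<Otimes>\<^sub>M PiM {..<n} (\<lambda>_. Q))"
    and Z: "\<And>s. s \<in> space M \<Longrightarrow> Z n s = H (x0 s, past n s)" by blast
  define N where "N = real n + shift"
  define B where "B = (borel :: (real ^ 'd) measure) \<Otimes>\<^sub>M PiM {..<Suc n} (\<lambda>_. Q)"
  define H1 where "H1 a = H (fst a, restrict (snd a) {..<n})" for a :: "(real ^ 'd) \<times> (nat \<Rightarrow> 'w)"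
  define H2 where "H2 a = step N (H1 a) (g (lookahead N (H1 a)) (snd a n))" for a
  have [measurable]: "(\<lambda>a. restrict (snd a) {..<n}) \<in> measurable B (PiM {..<n} (\<lambda>_. Q))"
    unfolding B_def by (rule measurable_compose[OF measurable_snd measurable_restrict_subset]) auto
  have [measurable]: "(\<lambda>a. snd a n) \<in> measurable B Q"
    unfolding B_def by (rule measurable_compose[OF measurable_snd measurable_component_singleton]) auto
  have [measurable]: "fst \<in> measurable B borel"
    unfolding B_def by measurable
  have [measurable]: "H1 \<in> borel_measurable B"
    unfolding H1_def[abs_def] by measurable
  have H2: "H2 \<in> borel_measurable B"
    unfolding H2_def[abs_def] by (intro measurable_step measurable_oracle) measurable
  have "restrict (past (Suc n) s) {..<n} = past n s" for s
    by (auto simp: restrict_def)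
  then have "\<forall>s\<in>space M. Z (Suc n) s = H2 (x0 s, past (Suc n) s)"
    by (simp add: Z_Suc Z H2_def H1_def N_def)
  then show ?case using H2 unfolding B_def by blast
qed

lemma past_measurable [measurable]: "past n \<in> measurable M (PiM {..<n} (\<lambda>_. Q))"
  by (rule measurable_restrict) measurable

lemma measurable_state [measurable]: "Z n \<in> borel_measurable M"
proof -
  obtain H where [measurable]: "H \<in> borel_measurable (borel \<Otimes>\<^sub>M PiM {..<n} (\<lambda>_. Q))"
    and Z: "\<And>s. s \<in> space M \<Longrightarrow> Z n s = H (x0 s, past n s)"
    using state_adapted by blast
  have "(\<lambda>s. H (x0 s, past n s)) \<in> borel_measurable M" by measurable
  then show ?thesis using measurable_cong[of M "Z n" "\<lambda>s. H (x0 s, past n s)"] Z by blast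
qed

lemma x0_indep_noise:
  "M.indep_pair borel x0 (PiM {..<n} (\<lambda>_. Q) \<Otimes>\<^sub>M Q) (\<lambda>s. (past n s, \<omega> n s))"
proof -
  have "(\<lambda>s n. \<omega> n s) \<in> measurable M (\<Pi>\<^sub>M n\<in>UNIV. Q)"
    by (rule measurable_PiM_single') (auto intro: measurable_space[OF measurable_omega])
  then have "M.indep_pair borel x0 (\<Pi>\<^sub>M n\<in>UNIV. Q) (\<lambda>s n. \<omega> n s)"
    using x0_indep by (intro M.indep_pair_of_indep_set x0_meas)
  moreover have "(\<lambda>w. (restrict w {..<n}, w n)) \<in> measurable (\<Pi>\<^sub>M n\<in>UNIV. Q) (PiM {..<n} (\<lambda>_. Q) \<Otimes>\<^sub>M Q)"
    by (rule measurable_Pair[OF measurable_restrict_subset measurable_component_singleton]) auto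
  ultimately show ?thesis
    using M.indep_pair_compose[OF _ measurable_ident, of borel x0 "\<Pi>\<^sub>M n\<in>UNIV. Q" "\<lambda>s n. \<omega> n s"
        "\<lambda>w. (restrict w {..<n}, w n)"] by simp
qed

text \<open>
  The state of iteration \<open>n\<close> is a function of \<open>x0\<close> and \<open>past n\<close>, so \<open>nn_integral_fresh\<close> allows averaging
  over \<open>\<omega> n\<close> with the state fixed, where \<open>expected_energy_step\<close> applies.
\<close>

lemma expected_energy_decay:
  fixes n :: nat
  defines "N \<equiv> real n + shift"
  defines "q \<equiv> 1 / (N + 1)"
  shows "(\<integral>\<^sup>+ s. ennreal (energy (N + 1) (Z (Suc n) s)) \<partial>M)
    \<le> ennreal (1 - q) * (\<integral>\<^sup>+ s. ennreal (energy N (Z n s)) \<partial>M) + ennreal (\<sigma>\<^sup>2 * (q\<^sup>2 / \<mu>))"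
proof -
  obtain H where [measurable]: "H \<in> borel_measurable (borel \<Otimes>\<^sub>M PiM {..<n} (\<lambda>_. Q))"
    and Z: "\<And>s. s \<in> space M \<Longrightarrow> Z n s = H (x0 s, past n s)"
    using state_adapted by blast
  define F where "F a = ennreal (energy (N + 1) (step N (H (fst a)) (g (lookahead N (H (fst a))) (snd a))))" for a
  have F: "F \<in> borel_measurable ((borel \<Otimes>\<^sub>M PiM {..<n} (\<lambda>_. Q)) \<Otimes>\<^sub>M Q)"
  proof -
    have [measurable]: "(\<lambda>a. step N (H (fst a)) (g (lookahead N (H (fst a))) (snd a)))
        \<in> borel_measurable ((borel \<Otimes>\<^sub>M PiM {..<n} (\<lambda>_. Q)) \<Otimes>\<^sub>M Q)"
      by (intro measurable_step measurable_oracle) measurable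
    show ?thesis unfolding F_def[abs_def] by measurable
  qed
  have "(\<integral>\<^sup>+ s. ennreal (energy (N + 1) (Z (Suc n) s)) \<partial>M) = (\<integral>\<^sup>+ s. F ((x0 s, past n s), \<omega> n s) \<partial>M)"
    by (intro nn_integral_cong) (simp add: F_def Z_Suc Z N_def)
  also have "\<dots> = (\<integral>\<^sup>+ s. \<integral>\<^sup>+ w. F ((x0 s, past n s), w) \<partial>Q \<partial>M)"
    using M.nn_integral_fresh[OF x0_indep_noise M.indep_pair_past_present[OF omega_indep] F]
    by (simp add: omega_law)
  also have "\<dots> \<le> (\<integral>\<^sup>+ s. ennreal (1 - q) * ennreal (energy N (Z n s)) + ennreal (\<sigma>\<^sup>2 * (q\<^sup>2 / \<mu>)) \<partial>M)"
  proof (rule nn_integral_mono)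
    fix s assume s: "s \<in> space M"
    have "N \<ge> shift + 1 \<or> N = shift \<and> snd (Z n s) = 0"
      using s by (cases n) (auto simp: N_def Z_0)
    then have "(\<integral>\<^sup>+ w. ennreal (energy (N + 1) (step N (Z n s) (g (lookahead N (Z n s)) w))) \<partial>Q)
        \<le> ennreal (1 - q) * ennreal (energy N (Z n s)) + ennreal (\<sigma>\<^sup>2 * (q\<^sup>2 / \<mu>))"
      unfolding q_def
      by (intro expected_energy_step Q g_unbiased g_square_int g_variance) measurable
    then show "(\<integral>\<^sup>+ w. F ((x0 s, past n s), w) \<partial>Q)
        \<le> ennreal (1 - q) * ennreal (energy N (Z n s)) + ennreal (\<sigma>\<^sup>2 * (q\<^sup>2 / \<mu>))"
      by (simp add: F_def Z[OF s])
  qed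
  also have "\<dots> = ennreal (1 - q) * (\<integral>\<^sup>+ s. ennreal (energy N (Z n s)) \<partial>M) + ennreal (\<sigma>\<^sup>2 * (q\<^sup>2 / \<mu>))"
    by (subst nn_integral_add) (auto simp: nn_integral_cmult M.emeasure_space_1)
  finally show ?thesis .
qed

text \<open>
  Since \<open>(N + 1) * (1 - q) = N\<close>, multiplying the decay estimate by \<open>N + 1\<close> gives a telescoping inequality,
  with the noise contribution \<open>\<sigma>\<^sup>2 / \<mu> * (1 / (N + 1))\<close>. The increment \<open>ln (N + 1) - ln N\<close> of the logarithm
  is at least \<open>1 / (N + 1)\<close>.
\<close>

lemma expected_energy_bound:
  "ennreal (real n + shift) * (\<integral>\<^sup>+ s. ennreal (energy (real n + shift) (Z n s)) \<partial>M)
    \<le> ennreal shift * (\<integral>\<^sup>+ s. ennreal (energy shift (Z 0 s)) \<partial>M)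
      + ennreal (\<sigma>\<^sup>2 / \<mu> * ln (1 + real n * (1 / shift)))"
proof (induction n)
  case 0
  show ?case by simp
next
  case (Suc n)
  define N where "N = real n + shift"
  define J where "J = (\<integral>\<^sup>+ s. ennreal (energy N (Z n s)) \<partial>M)"
  define J0 where "J0 = (\<integral>\<^sup>+ s. ennreal (energy shift (Z 0 s)) \<partial>M)"
  define l where "l = ln (1 + real n * (1 / shift))"
  have N1: "N \<ge> 1" using shift(1) by (simp add: N_def)
  have l0: "l \<ge> 0" unfolding l_def using shift(1) by (intro ln_ge_zero) simp
  have c: "\<sigma>\<^sup>2 / \<mu> \<ge> 0" using mu_pos by simp
  have ln_step: "l + 1 / (N + 1) \<le> ln (1 + real (Suc n) * (1 / shift))"
  proof -
    have 1: "1 + real n * (1 / shift) = N / shift" "1 + real (Suc n) * (1 / shift) = (N + 1) / shift"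
      using shift(1) by (simp_all add: N_def field_simps)
    have "ln (N / (N + 1)) \<le> N / (N + 1) - 1"
      using N1 by (intro ln_le_minus_one) simp
    moreover have "N / (N + 1) - 1 = - (1 / (N + 1))" using N1 by (simp add: field_simps)
    moreover have "ln (N / (N + 1)) = ln N - ln (N + 1)" using N1 by (simp add: ln_div)
    ultimately show ?thesis
      unfolding l_def 1 using N1 shift(1) by (simp add: ln_div)
  qed
  have "ennreal (N + 1) * (\<integral>\<^sup>+ s. ennreal (energy (N + 1) (Z (Suc n) s)) \<partial>M)
      \<le> ennreal (N + 1) * (ennreal (1 - 1 / (N + 1)) * J + ennreal (\<sigma>\<^sup>2 * ((1 / (N + 1))\<^sup>2 / \<mu>)))"
    unfolding J_def N_def by (intro mult_left_mono expected_energy_decay) auto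
  also have "\<dots> = ennreal N * J + ennreal (\<sigma>\<^sup>2 / \<mu> * (1 / (N + 1)))"
  proof -
    have "ennreal (N + 1) * ennreal (1 - 1 / (N + 1)) = ennreal N"
      using N1 by (subst ennreal_mult[symmetric]) (auto simp: field_simps)
    moreover have "ennreal (N + 1) * ennreal (\<sigma>\<^sup>2 * ((1 / (N + 1))\<^sup>2 / \<mu>)) = ennreal (\<sigma>\<^sup>2 / \<mu> * (1 / (N + 1)))"
      using N1 mu_pos by (subst ennreal_mult[symmetric]) (auto simp: power2_eq_square)
    ultimately show ?thesis by (simp add: distrib_left flip: mult.assoc)
  qed
  also have "\<dots> \<le> (ennreal shift * J0 + ennreal (\<sigma>\<^sup>2 / \<mu> * l)) + ennreal (\<sigma>\<^sup>2 / \<mu> * (1 / (N + 1)))"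
    using Suc.IH by (intro add_right_mono) (simp only: N_def J_def J0_def l_def)
  also have "\<dots> = ennreal shift * J0 + ennreal (\<sigma>\<^sup>2 / \<mu> * (l + 1 / (N + 1)))"
  proof -
    have "ennreal (\<sigma>\<^sup>2 / \<mu> * l) + ennreal (\<sigma>\<^sup>2 / \<mu> * (1 / (N + 1)))
        = ennreal (\<sigma>\<^sup>2 / \<mu> * l + \<sigma>\<^sup>2 / \<mu> * (1 / (N + 1)))"
      using c l0 N1 by (intro ennreal_plus[symmetric] mult_nonneg_nonneg) auto
    then show ?thesis by (simp only: add.assoc distrib_left)
  qed
  also have "\<dots> \<le> ennreal shift * J0 + ennreal (\<sigma>\<^sup>2 / \<mu> * ln (1 + real (Suc n) * (1 / shift)))"
    using ln_step c by (intro add_left_mono ennreal_leI mult_left_mono)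
  finally show ?case by (simp add: N_def J0_def add_ac)
qed

lemma gap_le_energy: "N \<ge> 1 \<Longrightarrow> gap (fst z) \<le> energy N z"
proof -
  assume N: "N \<ge> 1"
  then have "(1 / N)\<^sup>2 \<le> 1" by (simp add: power_le_one)
  then show ?thesis
    by (simp add: energy_def Let_def)
qed

lemma energy_at_rest: "energy N (y, 0) = gap y + \<mu> / 2 * (norm (offset y))\<^sup>2"
proof -
  have "normal 0 = 0" "P 0 = 0" using linear_normal linear_P by (auto simp: linear_0)
  then show ?thesis
    using mu_pos by (simp add: energy_def Let_def lookahead_def power_mult_distrib)
qed

lemma expected_gap_bound:
  "(\<integral>\<^sup>+ s. ennreal (gap (fst (Z n s))) \<partial>M) \<le>
    (ennreal shift * (\<integral>\<^sup>+ s. ennreal (gap (x0 s) + \<mu> / 2 * (norm (offset (x0 s)))\<^sup>2) \<partial>M)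
      + ennreal (\<sigma>\<^sup>2 / \<mu> * ln (1 + real n * (1 / shift)))) / ennreal (real n + shift)"
proof -
  define N where "N = real n + shift"
  have N1: "N \<ge> 1" using shift(1) by (simp add: N_def)
  have "(\<integral>\<^sup>+ s. ennreal (gap (fst (Z n s))) \<partial>M) \<le> (\<integral>\<^sup>+ s. ennreal (energy N (Z n s)) \<partial>M)"
    by (intro nn_integral_mono ennreal_leI gap_le_energy N1)
  also have "\<dots> = ennreal N * (\<integral>\<^sup>+ s. ennreal (energy N (Z n s)) \<partial>M) / ennreal N"
    using N1 by (subst mult.commute, subst mult_divide_eq_ennreal) auto
  also have "\<dots> \<le> (ennreal shift * (\<integral>\<^sup>+ s. ennreal (energy shift (Z 0 s)) \<partial>M)
      + ennreal (\<sigma>\<^sup>2 / \<mu> * ln (1 + real n * (1 / shift)))) / ennreal N"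
    unfolding N_def by (intro divide_right_mono_ennreal expected_energy_bound)
  also have "(\<integral>\<^sup>+ s. ennreal (energy shift (Z 0 s)) \<partial>M)
      = (\<integral>\<^sup>+ s. ennreal (gap (x0 s) + \<mu> / 2 * (norm (offset (x0 s)))\<^sup>2) \<partial>M)"
    by (intro nn_integral_cong) (simp add: Z_0 energy_at_rest)
  finally show ?thesis by (simp add: N_def)
qed

end

theorem theorem14:
  fixes f :: "real ^ 'd \<Rightarrow> real"
    and grad :: "real ^ 'd \<Rightarrow> real ^ 'd"
    and V :: "(real ^ 'd) set"
    and P \<pi> :: "real ^ 'd \<Rightarrow> real ^ 'd"
    and xstar :: "real ^ 'd"
    and L \<mu> \<epsilon> \<sigma> :: real
    and Q :: "'w measure"
    and g :: "real ^ 'd \<Rightarrow> 'w \<Rightarrow> real ^ 'd"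
    and M :: "'s measure"
    and \<omega> :: "nat \<Rightarrow> 's \<Rightarrow> 'w"
    and x x' v gn :: "nat \<Rightarrow> 's \<Rightarrow> real ^ 'd"
  assumes grad: "\<And>y. GDERIV f y :> grad y"
    and grad_cont: "continuous_on UNIV grad"
    and L_pos: "L > 0"
    and grad_lipschitz: "L-lipschitz_on UNIV grad"
    and f_bdd: "bdd_below (range f)"
    and mu_pos: "\<mu> > 0"
    and V_subspace: "subspace V"
    and V_dim: "dim V < CARD('d)"
    and P_proj: "is_orthogonal_projection V P"
    and minimizers_nonempty: "minimizers f \<noteq> {}"
    and minimizers_affine: "minimizers f = {xstar + u |u. u \<in> V}"
    and xstar_min_norm: "\<And>y. y \<in> minimizers f \<Longrightarrow> norm xstar \<le> norm y"
    and pi_closest: "\<And>y. \<pi> y = closest_point (minimizers f) y"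
    and pi_affine: "\<And>y. \<pi> y = P y + xstar"
    and strong_conv: "\<And>y. inner (grad y) (y - \<pi> y) \<ge>
          f y - f (\<pi> y) + \<mu> / 2 * (norm (y - \<pi> y))\<^sup>2"
    and weak_conv: "\<And>y u. inner (grad (y + u)) u \<ge>
          f (y + u) - f y - \<epsilon> / 2 * (norm u)\<^sup>2"
    and Q_prob: "prob_space Q"
    and g_meas: "(\<lambda>(y, w). g y w) \<in> borel_measurable (borel \<Otimes>\<^sub>M Q)"
    and g_unbiased: "\<And>y. (\<integral>w. g y w \<partial>Q) = grad y"
    and g_square_int: "\<And>y. integrable Q (\<lambda>w. (norm (g y w))\<^sup>2)"
    and sigma_nonneg: "\<sigma> \<ge> 0"
    and g_variance: "\<And>y. (\<integral>w. (norm (g y w - grad y))\<^sup>2 \<partial>Q) \<le> \<sigma>\<^sup>2"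
    and M_prob: "prob_space M"
    and x0_meas: "x 0 \<in> borel_measurable M"
    and omega_indep: "prob_space.indep_vars M (\<lambda>_. Q) \<omega> UNIV"
    and omega_law: "\<And>n. distr M Q (\<omega> n) = Q"
    and x0_indep: "prob_space.indep_set M
          (sets (vimage_algebra (space M) (x 0) borel))
          (sets (vimage_algebra (space M) (\<lambda>s n. \<omega> n s) (\<Pi>\<^sub>M n\<in>UNIV. Q)))"
    and v_0: "\<And>s. s \<in> space M \<Longrightarrow> v 0 s = 0"
    and x'_eq: "\<And>n s. s \<in> space M \<Longrightarrow>
          x' n s = x n s + sqrt (step_size L \<mu> (int n - 1)) *\<^sub>R v n s"
    and gn_eq: "\<And>n s. s \<in> space M \<Longrightarrow> gn n s = g (x' n s) (\<omega> n s)"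
    and x_Suc: "\<And>n s. s \<in> space M \<Longrightarrow>
          x (Suc n) s = x' n s - step_size L \<mu> (int n) *\<^sub>R gn n s"
    and v_Suc: "\<And>n s. s \<in> space M \<Longrightarrow>
          v (Suc n) s = momentum L \<mu> (int n) *\<^sub>R
            (v n s - sqrt (step_size L \<mu> (int n)) *\<^sub>R gn n s)"
    and eps_le: "\<epsilon> \<le> sqrt (\<mu> / step_size L \<mu> 0)"
  shows "\<forall>n. (\<integral>\<^sup>+ s. ennreal (f (x n s) - (INF z. f z)) \<partial>M) \<le>
      (ennreal (sqrt (L / \<mu>)) *
         (\<integral>\<^sup>+ s. ennreal (f (x 0 s) - (INF z. f z)
             + \<mu> / 2 * (norm (x 0 s - \<pi> (x 0 s)))\<^sup>2) \<partial>M)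
       + ennreal (\<sigma>\<^sup>2 / \<mu> * ln (1 + real n * sqrt (\<mu> / L))))
      / ennreal (real n + sqrt (L / \<mu>))"
proof -
  interpret affine_minimizers f grad V P xstar L \<mu> \<epsilon>
  proof (unfold_locales; (fact assms)?)
    fix y
    show "f y - f (P y + xstar) + \<mu> / 2 * (norm (y - (P y + xstar)))\<^sup>2 \<le> inner (grad y) (y - (P y + xstar))"
      using strong_conv[of y] unfolding pi_affine .
  qed
  define Z where "Z n s = (x n s, v n s)" for n s
  have look: "x' n s = lookahead (real n + shift) (Z n s)" if "s \<in> space M" for n s
    using x'_eq[OF that, of n] sqrt_step_size_pred[OF mu_pos L_pos, of n]
    by (simp add: lookahead_def Z_def shift_def)
  interpret stochastic_scheme f grad V P xstar L \<mu> \<epsilon> Q g \<sigma> M \<omega> "x 0" Z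
  proof (intro stochastic_scheme.intro stochastic_scheme_axioms.intro affine_minimizers_axioms;
      (fact Q_prob g_meas g_unbiased g_square_int g_variance M_prob x0_meas omega_indep omega_law x0_indep)?)
    fix s assume s: "s \<in> space M"
    show "Z 0 s = (x 0 s, 0)" using v_0[OF s] by (simp add: Z_def)
    show "Z (Suc n) s = step (real n + shift) (Z n s) (g (lookahead (real n + shift) (Z n s)) (\<omega> n s))" for n
      using x_Suc[OF s, of n] v_Suc[OF s, of n]
      unfolding step_size_nat(2)[OF mu_pos L_pos] unfolding step_size_nat(1,3)[OF mu_pos L_pos]
      by (simp add: Z_def step_def Let_def gn_eq[OF s] look[OF s] shift_def)
  qed
  have "sqrt (\<mu> / L) = 1 / shift"
    by (simp add: shift_def real_sqrt_divide)
  then show ?thesis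
    using expected_gap_bound
    by (simp add: Z_def gap_def offset_def pi_affine shift_def)
qed

end
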